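(* Let $\mathcal D=(D,d)$ and $\mathcal E=(E,d)$ be $A$-comodule dg algebras and let $\mathfrak X\in{}^A_{\mathcal D}\mathrm{dg\text{-}Mod}_{\mathcal E}$. The following are equivalent. 1. $\mathfrak X\in{}^A_{\mathcal D}\mathrm{dg}_0\text{-lproj}_{\mathcal E}$. 2. $\mathfrak X^0\in{}^A_{D^0}\mathrm{lproj}_{E^0}$ and the map $\mu:D\otimes_{D^0}\mathfrak X^0\to\mathfrak X$ induced by the left $D$-action is an isomorphism of $D$-$E^0$-modules. 3. As a graded left $D$-module, $\mathfrak X$ is a direct summand of $D^{\oplus m}$ for some $m\ge0$.
   Context: Everything is over $\mathbb C$; $A$ is a Hopf $*$-algebra. An $A$-comodule dg algebra $\mathcal D=(D,d)$ is a $\mathbb Z$-graded algebra $D=\bigoplus_iD^i$ with a degree one differential $d$ satisfying the graded Leibniz rule, and a left $A$-coaction preserving degrees, commuting with $d$ and for which the multiplication and unit are comodule maps. ${}^A_{\mathcal D}\mathrm{dg\text{-}Mod}_{\mathcal E}$ is the category of left $A$-comodule dg $\mathcal D$-$\mathcal E$-bimodules (graded bimodules with degree-one square-zero differential satisfying the graded Leibniz rule on both sides, and a compatible degree-preserving left $A$-coaction commuting with the differential). ${}^A_{\mathcal D}\mathrm{dg}_0\text{-lproj}_{\mathcal E}$ is the full subcategory of those objects that are projective as left $D$-modules (forgetting the differential) and are generated, as left $D$-modules, by finitely many elements of degree zero. $\mathfrak X^0$ is the degree zero component of $\mathfrak X$. ${}^A_{D^0}\mathrm{lproj}_{E^0}$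 is the category of left $A$-comodule $D^0$-$E^0$-bimodules (with compatible coaction) that are finitely generated projective as left $D^0$-modules. *)

theory Defs
  imports Complex_Main "HOL-Library.Poly_Mapping" "HOL-Library.Function_Algebras"
begin

section \<open>Complex vector spaces and complex algebras\<close>

class complex_vector = ab_group_add +
  fixes scaleC :: "complex \<Rightarrow> 'a \<Rightarrow> 'a" (infixr \<open>*\<^sub>C\<close> 75)
  assumes scaleC_add_right: "z *\<^sub>C (x + y) = z *\<^sub>C x + z *\<^sub>C y"
    and scaleC_add_left: "(z + w) *\<^sub>C x = z *\<^sub>C x + w *\<^sub>C x"
    and scaleC_scaleC: "z *\<^sub>C (w *\<^sub>C x) = (z * w) *\<^sub>C x"
    and scaleC_one: "1 *\<^sub>C x = x"

global_interpretation complex_vector: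
  vector_space "scaleC :: complex \<Rightarrow> 'a \<Rightarrow> 'a::complex_vector"
  by unfold_locales (rule scaleC_add_right scaleC_add_left scaleC_scaleC scaleC_one)+

text \<open>Associative unital algebras.  Based on \<^class>\<open>ring\<close> and \<^class>\<open>monoid_mult\<close> rather than
  on \<^class>\<open>ring_1\<close>, so that the zero algebra is not excluded.\<close>

class complex_algebra = complex_vector + ring + monoid_mult +
  assumes scaleC_mult_left: "(z *\<^sub>C x) * y = z *\<^sub>C (x * y)"
    and scaleC_mult_right: "x * (z *\<^sub>C y) = z *\<^sub>C (x * y)"

instantiation complex :: complex_vector
begin

definition scaleC_complex :: "complex \<Rightarrow> complex \<Rightarrow> complex"
  where "scaleC_complex z w = z * w"

instance
  by standard (simp_all add: scaleC_complex_def algebra_simps)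

end

instantiation "fun" :: (type, complex_vector) complex_vector
begin

definition scaleC_fun :: "complex \<Rightarrow> ('a \<Rightarrow> 'b) \<Rightarrow> 'a \<Rightarrow> 'b"
  where "scaleC_fun z f = (\<lambda>i. z *\<^sub>C f i)"

instance
  by standard (auto simp: scaleC_fun_def fun_eq_iff scaleC_add_right scaleC_add_left
      scaleC_scaleC scaleC_one)

end

abbreviation csubspace :: "'a::complex_vector set \<Rightarrow> bool"
  where "csubspace \<equiv> complex_vector.subspace"

abbreviation clinear :: "('a::complex_vector \<Rightarrow> 'b::complex_vector) \<Rightarrow> bool"
  where "clinear \<equiv> Vector_Spaces.linear scaleC scaleC"

definition cbilinear ::
    "('a::complex_vector \<Rightarrow> 'b::complex_vector \<Rightarrow> 'c::complex_vector) \<Rightarrow> bool"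
  where "cbilinear f \<longleftrightarrow> (\<forall>x. clinear (f x)) \<and> (\<forall>y. clinear (\<lambda>x. f x y))"

definition graded_by :: "'a::complex_vector set \<Rightarrow> (int \<Rightarrow> 'a set) \<Rightarrow> bool"
  where "graded_by V G \<longleftrightarrow> csubspace V \<and> (\<forall>i. csubspace (G i) \<and> G i \<subseteq> V) \<and>
    (\<forall>x\<in>V. \<exists>!c :: int \<Rightarrow> 'a.
        finite {i. c i \<noteq> 0} \<and> (\<forall>i. c i \<in> G i) \<and> x = (\<Sum>i | c i \<noteq> 0. c i))"


section \<open>Balanced tensor products\<close>

text \<open>For a right \<open>R\<close>-module \<open>M\<close> (action \<open>ra\<close>) and a left \<open>R\<close>-module \<open>N\<close> (action \<open>la\<close>), the tensor
  product of \<open>M\<close> and \<open>N\<close> over \<open>R\<close> is the free abelian group on \<open>M \<times> N\<close> modulo the subgroup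
  \<open>tensor_rels\<close>.\<close>

inductive_set tensor_rels ::
    "'r set \<Rightarrow> 'm::ab_group_add set \<Rightarrow> 'n::ab_group_add set \<Rightarrow> ('m \<Rightarrow> 'r \<Rightarrow> 'm) \<Rightarrow>
     ('r \<Rightarrow> 'n \<Rightarrow> 'n) \<Rightarrow> ('m \<times> 'n \<Rightarrow>\<^sub>0 int) set"
  for R M N ra la where
  zero: "0 \<in> tensor_rels R M N ra la"
| diff: "u \<in> tensor_rels R M N ra la \<Longrightarrow> v \<in> tensor_rels R M N ra la \<Longrightarrow>
     u - v \<in> tensor_rels R M N ra la"
| add_left: "m \<in> M \<Longrightarrow> m' \<in> M \<Longrightarrow> n \<in> N \<Longrightarrow>
     frag_of (m + m', n) - frag_of (m, n) - frag_of (m', n) \<in> tensor_rels R M N ra la"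
| add_right: "m \<in> M \<Longrightarrow> n \<in> N \<Longrightarrow> n' \<in> N \<Longrightarrow>
     frag_of (m, n + n') - frag_of (m, n) - frag_of (m, n') \<in> tensor_rels R M N ra la"
| balanced: "r \<in> R \<Longrightarrow> m \<in> M \<Longrightarrow> n \<in> N \<Longrightarrow>
     frag_of (ra m r, n) - frag_of (m, la r n) \<in> tensor_rels R M N ra la"

lemma tensor_rels_uminus:
  assumes "u \<in> tensor_rels R M N ra la"
  shows "- u \<in> tensor_rels R M N ra la"
  using tensor_rels.diff[OF tensor_rels.zero assms] by simp

lemma tensor_rels_add:
  assumes "u \<in> tensor_rels R M N ra la" "v \<in> tensor_rels R M N ra la"
  shows "u + v \<in> tensor_rels R M N ra la"
  using tensor_rels.diff[OF assms(1) tensor_rels_uminus[OF assms(2)]] by simp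

text \<open>The additive extension of a map on generators to the free abelian group.\<close>

definition frag_eval :: "('m \<Rightarrow> 'n \<Rightarrow> 'c::complex_vector) \<Rightarrow> ('m \<times> 'n \<Rightarrow>\<^sub>0 int) \<Rightarrow> 'c"
  where "frag_eval f u =
    (\<Sum>p\<in>Poly_Mapping.keys u. of_int (Poly_Mapping.lookup u p) *\<^sub>C f (fst p) (snd p))"

lemma frag_eval_superset:
  assumes "finite S" "Poly_Mapping.keys u \<subseteq> S"
  shows "frag_eval f u = (\<Sum>p\<in>S. of_int (Poly_Mapping.lookup u p) *\<^sub>C f (fst p) (snd p))"
  unfolding frag_eval_def
  by (rule sum.mono_neutral_left) (use assms in \<open>auto simp: in_keys_iff\<close>)

lemma frag_eval_zero [simp]: "frag_eval f 0 = 0"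
  by (simp add: frag_eval_def)

lemma frag_eval_of [simp]: "frag_eval f (frag_of (m, n)) = f m n"
  by (simp add: frag_eval_def scaleC_one)

lemma frag_eval_diff: "frag_eval f (u - v) = frag_eval f u - frag_eval f v"
proof -
  let ?S = "Poly_Mapping.keys u \<union> Poly_Mapping.keys v"
  have "frag_eval f (u - v) =
      (\<Sum>p\<in>?S. of_int (Poly_Mapping.lookup (u - v) p) *\<^sub>C f (fst p) (snd p))"
    by (rule frag_eval_superset) (simp_all add: keys_diff)
  also have "\<dots> = (\<Sum>p\<in>?S. of_int (Poly_Mapping.lookup u p) *\<^sub>C f (fst p) (snd p))
      - (\<Sum>p\<in>?S. of_int (Poly_Mapping.lookup v p) *\<^sub>C f (fst p) (snd p))"
    by (simp add: lookup_minus complex_vector.scale_left_diff_distrib sum_subtractf)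
  also have "\<dots> = frag_eval f u - frag_eval f v"
    by (simp add: frag_eval_superset[of ?S])
  finally show ?thesis .
qed

lemma frag_eval_add: "frag_eval f (u + v) = frag_eval f u + frag_eval f v"
  using frag_eval_diff[of f "u + v" v] by (simp add: algebra_simps)

lemma frag_eval_tensor_rels:
  assumes "u \<in> tensor_rels R M N ra la"
    and "\<And>m m' n. m \<in> M \<Longrightarrow> m' \<in> M \<Longrightarrow> n \<in> N \<Longrightarrow> f (m + m') n = f m n + f m' n"
    and "\<And>m n n'. m \<in> M \<Longrightarrow> n \<in> N \<Longrightarrow> n' \<in> N \<Longrightarrow> f m (n + n') = f m n + f m n'"
    and "\<And>r m n. r \<in> R \<Longrightarrow> m \<in> M \<Longrightarrow> n \<in> N \<Longrightarrow> f (ra m r) n = f m (la r n)"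
  shows "frag_eval f u = 0"
  using assms(1) by induction (simp_all add: frag_eval_diff assms(2-4))


subsection \<open>The tensor product over the complex numbers\<close>

abbreviation ctensor_rels :: "('a::complex_vector \<times> 'b::complex_vector \<Rightarrow>\<^sub>0 int) set"
  where "ctensor_rels \<equiv> tensor_rels UNIV UNIV UNIV (\<lambda>a z. z *\<^sub>C a) (\<lambda>z b. z *\<^sub>C b)"

definition ctensor_eq ::
    "('a::complex_vector \<times> 'b::complex_vector \<Rightarrow>\<^sub>0 int) \<Rightarrow> ('a \<times> 'b \<Rightarrow>\<^sub>0 int) \<Rightarrow> bool"
  where "ctensor_eq u v \<longleftrightarrow> u - v \<in> ctensor_rels"

lemma equivp_ctensor_eq: "equivp ctensor_eq"
proof (rule equivpI)
  show "reflp ctensor_eq"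
    by (simp add: reflp_def ctensor_eq_def tensor_rels.zero)
  show "symp ctensor_eq"
    unfolding symp_def ctensor_eq_def by (metis minus_diff_eq tensor_rels_uminus)
  show "transp ctensor_eq"
    unfolding transp_def ctensor_eq_def by (auto dest: tensor_rels_add)
qed

quotient_type (overloaded) ('a, 'b) ctensor (infixr \<open>\<otimes>\<close> 75) =
  "('a::complex_vector \<times> 'b::complex_vector) \<Rightarrow>\<^sub>0 int" / ctensor_eq
  by (rule equivp_ctensor_eq)

lift_definition ctensor_of :: "'a::complex_vector \<Rightarrow> 'b::complex_vector \<Rightarrow> 'a \<otimes> 'b"
  (infixr \<open>\<otimes>\<^sub>C\<close> 75) is "\<lambda>a b. frag_of (a, b)" .

definition scale_frag ::
    "complex \<Rightarrow> ('a::complex_vector \<times> 'b::complex_vector \<Rightarrow>\<^sub>0 int) \<Rightarrow> ('a \<times> 'b \<Rightarrow>\<^sub>0 int)"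
  where "scale_frag z = frag_extend (\<lambda>(a, b). frag_of (z *\<^sub>C a, b))"

lemma scale_frag_rels:
  assumes "u \<in> ctensor_rels"
  shows "scale_frag z u \<in> ctensor_rels"
  using assms
proof induction
  case (balanced r m n)
  have "z *\<^sub>C r *\<^sub>C m = r *\<^sub>C z *\<^sub>C m"
    by (simp add: scaleC_scaleC mult.commute)
  then show ?case
    using tensor_rels.balanced[where r = r and m = "z *\<^sub>C m" and n = n and R = UNIV and M = UNIV
        and N = UNIV and ra = "\<lambda>a z. z *\<^sub>C a" and la = "\<lambda>z b. z *\<^sub>C b"]
    by (simp add: scale_frag_def frag_extend_diff scaleC_scaleC mult.commute)
qed (auto simp: scale_frag_def frag_extend_diff scaleC_add_right intro: tensor_rels.intros)

instantiation ctensor :: (complex_vector, complex_vector) complex_vector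
begin

lift_definition zero_ctensor :: "'a \<otimes> 'b" is 0 .

lift_definition plus_ctensor :: "'a \<otimes> 'b \<Rightarrow> 'a \<otimes> 'b \<Rightarrow> 'a \<otimes> 'b" is "(+)"
  unfolding ctensor_eq_def by (simp add: add_diff_add tensor_rels_add)

lift_definition minus_ctensor :: "'a \<otimes> 'b \<Rightarrow> 'a \<otimes> 'b \<Rightarrow> 'a \<otimes> 'b" is "(-)"
proof -
  fix u u' v v' :: "'a \<times> 'b \<Rightarrow>\<^sub>0 int"
  assume "ctensor_eq u u'" "ctensor_eq v v'"
  then have "(u - u') - (v - v') \<in> ctensor_rels"
    unfolding ctensor_eq_def by (rule tensor_rels.diff)
  moreover have "(u - u') - (v - v') = (u - v) - (u' - v')"
    by simp
  ultimately show "ctensor_eq (u - v) (u' - v')"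
    unfolding ctensor_eq_def by (simp only:)
qed

lift_definition uminus_ctensor :: "'a \<otimes> 'b \<Rightarrow> 'a \<otimes> 'b" is "uminus"
  unfolding ctensor_eq_def by (simp only: minus_diff_minus tensor_rels_uminus)

lift_definition scaleC_ctensor :: "complex \<Rightarrow> 'a \<otimes> 'b \<Rightarrow> 'a \<otimes> 'b" is scale_frag
  unfolding ctensor_eq_def
  by (simp only: scale_frag_def frag_extend_diff[symmetric])
    (simp only: scale_frag_def[symmetric] scale_frag_rels)

instance
proof
  fix x y t :: "'a \<otimes> 'b" and z w :: complex
  show "x + y + t = x + (y + t)"
    by transfer (simp add: ctensor_eq_def tensor_rels.zero add.assoc)
  show "x + y = y + x"
    by transfer (simp add: ctensor_eq_def tensor_rels.zero add.commute)
  show "0 + x = x"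
    by transfer (simp add: ctensor_eq_def tensor_rels.zero)
  show "- x + x = 0"
    by transfer (simp add: ctensor_eq_def tensor_rels.zero)
  show "x - y = x + - y"
    by transfer (simp add: ctensor_eq_def tensor_rels.zero)
  show "z *\<^sub>C (x + y) = z *\<^sub>C x + z *\<^sub>C y"
    by transfer (simp add: ctensor_eq_def tensor_rels.zero scale_frag_def frag_extend_add)
  show "z *\<^sub>C (w *\<^sub>C x) = (z * w) *\<^sub>C x"
  proof transfer
    fix z w :: complex and u :: "'a \<times> 'b \<Rightarrow>\<^sub>0 int"
    have "scale_frag z (scale_frag w u) = scale_frag (z * w) u"
      by (induction u rule: frag_induction[where S = UNIV, OF subset_UNIV])
        (auto simp: scale_frag_def frag_extend_diff scaleC_scaleC)
    then show "ctensor_eq (scale_frag z (scale_frag w u)) (scale_frag (z * w) u)"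
      by (simp add: ctensor_eq_def tensor_rels.zero)
  qed
  show "1 *\<^sub>C x = x"
  proof transfer
    fix u :: "'a \<times> 'b \<Rightarrow>\<^sub>0 int"
    have "scale_frag 1 u = u"
      by (induction u rule: frag_induction[where S = UNIV, OF subset_UNIV])
        (auto simp: scale_frag_def frag_extend_diff scaleC_one)
    then show "ctensor_eq (scale_frag 1 u) u"
      by (simp add: ctensor_eq_def tensor_rels.zero)
  qed
  show "(z + w) *\<^sub>C x = z *\<^sub>C x + w *\<^sub>C x"
  proof transfer
    fix z w :: complex and u :: "'a \<times> 'b \<Rightarrow>\<^sub>0 int"
    have "scale_frag (z + w) u - scale_frag z u - scale_frag w u \<in> ctensor_rels"
    proof (induction u rule: frag_induction[where S = UNIV, OF subset_UNIV])
      case (3 a b)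
      have "scale_frag (z + w) (a - b) - scale_frag z (a - b) - scale_frag w (a - b) =
        (scale_frag (z + w) a - scale_frag z a - scale_frag w a) -
        (scale_frag (z + w) b - scale_frag z b - scale_frag w b)"
        by (simp add: scale_frag_def frag_extend_diff)
      then show ?case
        using 3 by (simp only: tensor_rels.diff)
    qed (auto simp: scale_frag_def scaleC_add_left intro: tensor_rels.intros)
    then show "ctensor_eq (scale_frag (z + w) u) (scale_frag z u + scale_frag w u)"
      by (simp add: ctensor_eq_def diff_diff_eq)
  qed
qed

end

text \<open>The additive map on the tensor product induced by a biadditive map \<open>f\<close> that satisfies
  \<open>f (z *\<^sub>C a) b = f a (z *\<^sub>C b)\<close>.  Besides complex bilinear maps this also covers maps that
  are conjugate linear in both arguments.\<close>

definition ctensor_lift ::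
    "('a::complex_vector \<Rightarrow> 'b::complex_vector \<Rightarrow> 'c::complex_vector) \<Rightarrow> 'a \<otimes> 'b \<Rightarrow> 'c"
  where "ctensor_lift f t = frag_eval f (rep_ctensor t)"

lemma ctensor_lift:
  fixes f :: "'a::complex_vector \<Rightarrow> 'b::complex_vector \<Rightarrow> 'c::complex_vector"
  assumes l: "\<And>a a' b. f (a + a') b = f a b + f a' b"
    and r: "\<And>a b b'. f a (b + b') = f a b + f a b'"
    and b: "\<And>z a b. f (z *\<^sub>C a) b = f a (z *\<^sub>C b)"
  shows ctensor_lift_of: "ctensor_lift f (a \<otimes>\<^sub>C b) = f a b"
    and ctensor_lift_add: "ctensor_lift f (s + t) = ctensor_lift f s + ctensor_lift f t"
proof -
  have abs: "ctensor_lift f (abs_ctensor u) = frag_eval f u" for u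
  proof -
    have "ctensor_eq (rep_ctensor (abs_ctensor u)) u"
      by (rule Quotient3_rep_abs[OF Quotient3_ctensor])
        (simp add: ctensor_eq_def tensor_rels.zero)
    then have "frag_eval f (rep_ctensor (abs_ctensor u) - u) = 0"
      unfolding ctensor_eq_def by (rule frag_eval_tensor_rels) (simp_all add: l r b)
    then show ?thesis
      by (simp add: ctensor_lift_def frag_eval_diff)
  qed
  show "ctensor_lift f (a \<otimes>\<^sub>C b) = f a b"
    by (simp add: ctensor_of.abs_eq abs)
  obtain u v where "s = abs_ctensor u" "t = abs_ctensor v"
    using Quotient3_abs_rep[OF Quotient3_ctensor] by metis
  then show "ctensor_lift f (s + t) = ctensor_lift f s + ctensor_lift f t"
    by (simp add: plus_ctensor.abs_eq abs frag_eval_add)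
qed

definition ctensor_map :: "('a::complex_vector \<Rightarrow> 'c::complex_vector) \<Rightarrow>
    ('b::complex_vector \<Rightarrow> 'd::complex_vector) \<Rightarrow> 'a \<otimes> 'b \<Rightarrow> 'c \<otimes> 'd"
  where "ctensor_map f g = ctensor_lift (\<lambda>a b. f a \<otimes>\<^sub>C g b)"

definition ctensor_assoc ::
    "('a::complex_vector \<otimes> 'b::complex_vector) \<otimes> 'c::complex_vector \<Rightarrow> 'a \<otimes> ('b \<otimes> 'c)"
  where "ctensor_assoc = ctensor_lift (\<lambda>t c. ctensor_lift (\<lambda>a b. a \<otimes>\<^sub>C (b \<otimes>\<^sub>C c)) t)"

text \<open>The bilinear map sending \<open>(a \<otimes> b, c \<otimes> d)\<close> to \<open>f a c \<otimes> g b d\<close>.\<close>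

definition ctensor_map2 ::
    "('a::complex_vector \<Rightarrow> 'c::complex_vector \<Rightarrow> 'p::complex_vector) \<Rightarrow>
     ('b::complex_vector \<Rightarrow> 'd::complex_vector \<Rightarrow> 'q::complex_vector) \<Rightarrow>
     'a \<otimes> 'b \<Rightarrow> 'c \<otimes> 'd \<Rightarrow> 'p \<otimes> 'q"
  where "ctensor_map2 f g s t =
    ctensor_lift (\<lambda>a b. ctensor_lift (\<lambda>c d. f a c \<otimes>\<^sub>C g b d) t) s"

text \<open>\<open>A \<otimes> V\<close> inside \<open>A \<otimes> W\<close>, for a subspace \<open>V\<close> of \<open>W\<close>.\<close>

definition ctensor_sub :: "'b::complex_vector set \<Rightarrow> ('a::complex_vector \<otimes> 'b) set"
  where "ctensor_sub V = complex_vector.span {a \<otimes>\<^sub>C v | a v. v \<in> V}"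


subsection \<open>The tensor product over a ring, as a set of cosets\<close>

definition tensor_class :: "'r set \<Rightarrow> 'm::ab_group_add set \<Rightarrow> 'n::ab_group_add set \<Rightarrow>
    ('m \<Rightarrow> 'r \<Rightarrow> 'm) \<Rightarrow> ('r \<Rightarrow> 'n \<Rightarrow> 'n) \<Rightarrow> ('m \<times> 'n \<Rightarrow>\<^sub>0 int) \<Rightarrow> ('m \<times> 'n \<Rightarrow>\<^sub>0 int) set"
  where "tensor_class R M N ra la u = {v. v - u \<in> tensor_rels R M N ra la}"

definition tensor_carrier :: "'r set \<Rightarrow> 'm::ab_group_add set \<Rightarrow> 'n::ab_group_add set \<Rightarrow>
    ('m \<Rightarrow> 'r \<Rightarrow> 'm) \<Rightarrow> ('r \<Rightarrow> 'n \<Rightarrow> 'n) \<Rightarrow> ('m \<times> 'n \<Rightarrow>\<^sub>0 int) set set"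
  where "tensor_carrier R M N ra la =
    tensor_class R M N ra la ` {u. Poly_Mapping.keys u \<subseteq> M \<times> N}"

definition coset_add :: "('p \<Rightarrow>\<^sub>0 int) set \<Rightarrow> ('p \<Rightarrow>\<^sub>0 int) set \<Rightarrow> ('p \<Rightarrow>\<^sub>0 int) set"
  where "coset_add S T = {u + v | u v. u \<in> S \<and> v \<in> T}"

text \<open>The endomorphism of the quotient by \<open>K\<close> that is induced by a map \<open>h\<close> of generators.\<close>

definition coset_map ::
    "('p \<Rightarrow>\<^sub>0 int) set \<Rightarrow> ('p \<Rightarrow> 'p) \<Rightarrow> ('p \<Rightarrow>\<^sub>0 int) set \<Rightarrow> ('p \<Rightarrow>\<^sub>0 int) set"
  where "coset_map K h S = {v. \<exists>u\<in>S. v - frag_extend (\<lambda>p. frag_of (h p)) u \<in> K}"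

text \<open>The map induced on cosets by a balanced biadditive map \<open>f\<close>; \<open>frag_eval f\<close> is then constant
  on each coset.\<close>

definition coset_eval ::
    "('m \<Rightarrow> 'n \<Rightarrow> 'c::complex_vector) \<Rightarrow> ('m \<times> 'n \<Rightarrow>\<^sub>0 int) set \<Rightarrow> 'c"
  where "coset_eval f S = the_elem (frag_eval f ` S)"

lemma coset_eval_class:
  assumes "\<And>m m' n. m \<in> M \<Longrightarrow> m' \<in> M \<Longrightarrow> n \<in> N \<Longrightarrow> f (m + m') n = f m n + f m' n"
    and "\<And>m n n'. m \<in> M \<Longrightarrow> n \<in> N \<Longrightarrow> n' \<in> N \<Longrightarrow> f m (n + n') = f m n + f m n'"
    and "\<And>r m n. r \<in> R \<Longrightarrow> m \<in> M \<Longrightarrow> n \<in> N \<Longrightarrow> f (ra m r) n = f m (la r n)"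
  shows "coset_eval f (tensor_class R M N ra la u) = frag_eval f u"
proof -
  have "frag_eval f v = frag_eval f u" if "v \<in> tensor_class R M N ra la u" for v
  proof -
    have "frag_eval f (v - u) = 0"
      by (rule frag_eval_tensor_rels[of "v - u" R M N ra la])
        (use that assms in \<open>auto simp: tensor_class_def\<close>)
    then show ?thesis
      by (simp add: frag_eval_diff)
  qed
  moreover have "u \<in> tensor_class R M N ra la u"
    by (simp add: tensor_class_def tensor_rels.zero)
  ultimately have "frag_eval f ` tensor_class R M N ra la u = {frag_eval f u}"
    by blast
  then show ?thesis
    by (simp add: coset_eval_def)
qed


section \<open>Modules over subrings\<close>

text \<open>In this section the ring is a unital subring \<open>R\<close> of the ambient ring \<open>'r\<close>, and modules
  are additive subgroups of the ambient group.\<close>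

locale left_module =
  fixes R :: "'r::{ring,monoid_mult} set" and M :: "'m::ab_group_add set"
    and act :: "'r \<Rightarrow> 'm \<Rightarrow> 'm"
  assumes zero_mem: "0 \<in> M"
    and diff_mem: "x \<in> M \<Longrightarrow> y \<in> M \<Longrightarrow> x - y \<in> M"
    and act_mem: "r \<in> R \<Longrightarrow> x \<in> M \<Longrightarrow> act r x \<in> M"
    and act_add_right: "r \<in> R \<Longrightarrow> x \<in> M \<Longrightarrow> y \<in> M \<Longrightarrow> act r (x + y) = act r x + act r y"
    and act_add_left: "r \<in> R \<Longrightarrow> s \<in> R \<Longrightarrow> x \<in> M \<Longrightarrow> act (r + s) x = act r x + act s x"
    and act_act: "r \<in> R \<Longrightarrow> s \<in> R \<Longrightarrow> x \<in> M \<Longrightarrow> act r (act s x) = act (r * s) x"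
    and act_one: "x \<in> M \<Longrightarrow> act 1 x = x"

locale right_module =
  fixes R :: "'r::{ring,monoid_mult} set" and M :: "'m::ab_group_add set"
    and act :: "'m \<Rightarrow> 'r \<Rightarrow> 'm"
  assumes zero_mem: "0 \<in> M"
    and diff_mem: "x \<in> M \<Longrightarrow> y \<in> M \<Longrightarrow> x - y \<in> M"
    and act_mem: "r \<in> R \<Longrightarrow> x \<in> M \<Longrightarrow> act x r \<in> M"
    and act_add_left: "r \<in> R \<Longrightarrow> x \<in> M \<Longrightarrow> y \<in> M \<Longrightarrow> act (x + y) r = act x r + act y r"
    and act_add_right: "r \<in> R \<Longrightarrow> s \<in> R \<Longrightarrow> x \<in> M \<Longrightarrow> act x (r + s) = act x r + act x s"
    and act_act: "r \<in> R \<Longrightarrow> s \<in> R \<Longrightarrow> x \<in> M \<Longrightarrow> act (act x r) s = act x (r * s)"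
    and act_one: "x \<in> M \<Longrightarrow> act x 1 = x"

definition left_module_hom ::
    "'r set \<Rightarrow> 'm::ab_group_add set \<Rightarrow> ('r \<Rightarrow> 'm \<Rightarrow> 'm) \<Rightarrow> 'n::ab_group_add set \<Rightarrow>
     ('r \<Rightarrow> 'n \<Rightarrow> 'n) \<Rightarrow> ('m \<Rightarrow> 'n) \<Rightarrow> bool"
  where "left_module_hom R M actM N actN f \<longleftrightarrow> f ` M \<subseteq> N \<and>
    (\<forall>x\<in>M. \<forall>y\<in>M. f (x + y) = f x + f y) \<and> (\<forall>r\<in>R. \<forall>x\<in>M. f (actM r x) = actN r (f x))"

text \<open>Projectivity is the lifting property against surjections.  A definition cannot quantify over
  types, so the test modules live in the types \<open>'m \<Rightarrow> 'r\<close> (which contains the free module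
  on \<open>P\<close>) and \<open>'m\<close>.  This is no restriction: by \<open>projective_lifts\<close> below the lifting
  property holds for test modules in arbitrary types.\<close>

definition projective ::
    "'r::{ring,monoid_mult} set \<Rightarrow> 'm::ab_group_add set \<Rightarrow> ('r \<Rightarrow> 'm \<Rightarrow> 'm) \<Rightarrow> bool"
  where "projective R P act \<longleftrightarrow> left_module R P act \<and>
    (\<forall>(M :: ('m \<Rightarrow> 'r) set) actM (N :: 'm set) actN f g.
      left_module R M actM \<and> left_module R N actN \<and>
      left_module_hom R M actM N actN f \<and> f ` M = N \<and> left_module_hom R P act N actN g
      \<longrightarrow> (\<exists>h. left_module_hom R P act M actM h \<and> (\<forall>x\<in>P. f (h x) = g x)))"

definition left_span :: "'r set \<Rightarrow> ('r \<Rightarrow> 'm \<Rightarrow> 'm) \<Rightarrow> 'm::ab_group_add set \<Rightarrow> 'm set"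
  where "left_span R act G =
    {(\<Sum>g\<in>T. act (c g) g) | c T. finite T \<and> T \<subseteq> G \<and> (\<forall>g\<in>T. c g \<in> R)}"

definition free_on :: "'r::{ring,monoid_mult} set \<Rightarrow> 'm set \<Rightarrow> ('m \<Rightarrow> 'r) set"
  where "free_on R P = {c. finite {x. c x \<noteq> 0} \<and> {x. c x \<noteq> 0} \<subseteq> P \<and> (\<forall>x. c x \<in> R)}"

lemma left_module_free_on:
  assumes "0 \<in> R" "\<And>r s. r \<in> R \<Longrightarrow> s \<in> R \<Longrightarrow> r - s \<in> R" "\<And>r s. r \<in> R \<Longrightarrow> s \<in> R \<Longrightarrow> r * s \<in> R"
  shows "left_module R (free_on R P) (\<lambda>r c x. r * c x)"
proof
  fix c d :: "'b \<Rightarrow> 'a" assume cd: "c \<in> free_on R P" "d \<in> free_on R P"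
  have sub: "{x. (c - d) x \<noteq> 0} \<subseteq> {x. c x \<noteq> 0} \<union> {x. d x \<noteq> 0}"
    by auto
  have "finite ({x. c x \<noteq> 0} \<union> {x. d x \<noteq> 0})" "{x. c x \<noteq> 0} \<union> {x. d x \<noteq> 0} \<subseteq> P"
    using cd by (simp_all add: free_on_def)
  with sub have "finite {x. (c - d) x \<noteq> 0}" "{x. (c - d) x \<noteq> 0} \<subseteq> P"
    by (blast intro: finite_subset)+
  with cd assms(2) show "c - d \<in> free_on R P"
    by (simp add: free_on_def)
next
  fix r and c :: "'b \<Rightarrow> 'a" assume "r \<in> R" and c: "c \<in> free_on R P"
  have sub: "{x. r * c x \<noteq> 0} \<subseteq> {x. c x \<noteq> 0}"
    by auto
  have "finite {x. c x \<noteq> 0}" "{x. c x \<noteq> 0} \<subseteq> P"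
    using c by (simp_all add: free_on_def)
  with sub have "finite {x. r * c x \<noteq> 0}" "{x. r * c x \<noteq> 0} \<subseteq> P"
    by (blast intro: finite_subset)+
  with \<open>r \<in> R\<close> c assms(3) show "(\<lambda>x. r * c x) \<in> free_on R P"
    by (simp add: free_on_def)
qed (use assms(1) in \<open>auto simp: free_on_def fun_eq_iff algebra_simps\<close>)

lemma left_module_sum_mem:
  assumes "left_module R M act" "finite S" "\<And>x. x \<in> S \<Longrightarrow> f x \<in> M"
  shows "sum f S \<in> M"
proof -
  interpret left_module R M act by fact
  have "x + y \<in> M" if "x \<in> M" "y \<in> M" for x y
    using diff_mem[OF that(1) diff_mem[OF zero_mem that(2)]] by simp
  with assms(2,3) zero_mem show ?thesis
    by (induction S rule: finite_induct) auto
qed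

lemma left_module_hom_sum:
  assumes "left_module R M actM" "left_module R N actN" "left_module_hom R M actM N actN f"
    and "finite S" "\<And>x. x \<in> S \<Longrightarrow> e x \<in> M"
  shows "f (sum e S) = (\<Sum>x\<in>S. f (e x))"
  using assms(4,5)
proof (induction S rule: finite_induct)
  case empty
  have "f (0 + 0) = f 0 + f 0"
    using assms(3) left_module.zero_mem[OF assms(1)] by (simp only: left_module_hom_def)
  then show ?case by simp
next
  case (insert x S)
  then have "sum e S \<in> M"
    using left_module_sum_mem[OF assms(1), of S e] by simp
  with insert assms(3) show ?case
    by (simp add: left_module_hom_def)
qed

lemma free_on_eval_hom:
  assumes "left_module R M act" and R: "\<And>r s. r \<in> R \<Longrightarrow> s \<in> R \<Longrightarrow> r * s \<in> R" "0 \<in> R"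
    and e: "\<And>x. x \<in> P \<Longrightarrow> e x \<in> M"
  shows "left_module_hom R (free_on R P) (\<lambda>r c x. r * c x) M act
    (\<lambda>c. \<Sum>x | c x \<noteq> 0. act (c x) (e x))"
proof -
  interpret left_module R M act by fact
  have zl: "act 0 x = 0" if "x \<in> M" for x
    using act_add_left[of 0 0 x] that R by simp
  have sup: "(\<Sum>x | c x \<noteq> 0. act (c x) (e x)) = (\<Sum>x\<in>S. act (c x) (e x))"
    if "finite S" "{x. c x \<noteq> 0} \<subseteq> S" "S \<subseteq> P" for c S
    by (rule sum.mono_neutral_left) (use that zl e in auto)
  have "(\<Sum>x | (c + d) x \<noteq> 0. act ((c + d) x) (e x)) =
      (\<Sum>x | c x \<noteq> 0. act (c x) (e x)) + (\<Sum>x | d x \<noteq> 0. act (d x) (e x))"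
    if "c \<in> free_on R P" "d \<in> free_on R P" for c d
  proof -
    let ?S = "{x. c x \<noteq> 0} \<union> {x. d x \<noteq> 0}"
    have S: "finite ?S" "?S \<subseteq> P" "{x. (c + d) x \<noteq> 0} \<subseteq> ?S"
      using that by (auto simp: free_on_def)
    have "(\<Sum>x\<in>?S. act ((c + d) x) (e x)) = (\<Sum>x\<in>?S. act (c x) (e x) + act (d x) (e x))"
    proof (rule sum.cong)
      fix x assume "x \<in> ?S"
      then have "x \<in> P" using S by blast
      then show "act ((c + d) x) (e x) = act (c x) (e x) + act (d x) (e x)"
        using that e act_add_left by (simp add: free_on_def)
    qed simp
    with S sup[of ?S c] sup[of ?S d] sup[of ?S "c + d"] show ?thesis
      by (simp add: sum.distrib)
  qed
  moreover have "(\<Sum>x | r * c x \<noteq> 0. act (r * c x) (e x)) =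
      act r (\<Sum>x | c x \<noteq> 0. act (c x) (e x))"
    if "r \<in> R" "c \<in> free_on R P" for r c
  proof -
    let ?S = "{x. c x \<noteq> 0}"
    have S: "finite ?S" "?S \<subseteq> P" "{x. r * c x \<noteq> 0} \<subseteq> ?S"
      using that by (auto simp: free_on_def)
    have m: "act (c x) (e x) \<in> M" if "x \<in> ?S" for x
      using that S e \<open>c \<in> free_on R P\<close> by (auto simp: free_on_def intro!: act_mem)
    have h: "left_module_hom {} M (\<lambda>_ x. x) M (\<lambda>_ x. x) (act r)"
      using that act_mem act_add_right by (auto simp: left_module_hom_def)
    have lm: "left_module {} M (\<lambda>_ x. x)"
      using zero_mem diff_mem by unfold_locales auto
    have "act r (\<Sum>x\<in>?S. act (c x) (e x)) = (\<Sum>x\<in>?S. act r (act (c x) (e x)))"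
      by (rule left_module_hom_sum[OF lm lm h]) (use S m in auto)
    also have "\<dots> = (\<Sum>x\<in>?S. act (r * c x) (e x))"
      by (rule sum.cong) (use that S e act_act in \<open>auto simp: free_on_def\<close>)
    also have "\<dots> = (\<Sum>x | r * c x \<noteq> 0. act (r * c x) (e x))"
      using sup[of ?S "\<lambda>x. r * c x"] S by simp
    finally show ?thesis by simp
  qed
  moreover have "(\<Sum>x | c x \<noteq> 0. act (c x) (e x)) \<in> M" if "c \<in> free_on R P" for c
    using that e by (intro left_module_sum_mem[OF assms(1)]) (auto simp: free_on_def intro!: act_mem)
  ultimately show ?thesis
    by (auto simp: left_module_hom_def)
qed

theorem projective_lifts:
  fixes R :: "'r::{ring,monoid_mult} set" and P :: "'m::ab_group_add set"
    and M :: "'a::ab_group_add set" and N :: "'b::ab_group_add set"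
  assumes R: "0 \<in> R" "1 \<in> R" "\<And>r s. r \<in> R \<Longrightarrow> s \<in> R \<Longrightarrow> r - s \<in> R"
      "\<And>r s. r \<in> R \<Longrightarrow> s \<in> R \<Longrightarrow> r * s \<in> R"
    and P: "projective R P act"
    and M: "left_module R M actM" and N: "left_module R N actN"
    and f: "left_module_hom R M actM N actN f" "f ` M = N"
    and g: "left_module_hom R P act N actN g"
  shows "\<exists>h. left_module_hom R P act M actM h \<and> (\<forall>x\<in>P. f (h x) = g x)"
proof -
  let ?F = "free_on R P" and ?a = "\<lambda>(r::'r) (c::'m \<Rightarrow> 'r) x. r * c x"
  let ?\<pi> = "\<lambda>c. \<Sum>x | c x \<noteq> 0. act (c x) x"
  have Pm: "left_module R P act"
    using P by (simp add: projective_def)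
  have Fm: "left_module R ?F ?a"
    by (rule left_module_free_on) (use R in auto)
  have \<pi>: "left_module_hom R ?F ?a P act ?\<pi>"
    using free_on_eval_hom[OF Pm, of P "\<lambda>x. x"] R by simp
  have "x \<in> ?\<pi> ` ?F" if x: "x \<in> P" for x
  proof
    let ?c = "\<lambda>y. if y = x then 1 else (0::'r)"
    show "?c \<in> ?F"
      using x R by (auto simp: free_on_def intro: rev_finite_subset[of "{x}"])
    have "(\<Sum>y | ?c y \<noteq> 0. act (?c y) y) = (\<Sum>y\<in>{x}. act (?c y) y)"
    proof (rule sum.mono_neutral_left)
      have "act 0 x = 0"
        using left_module.act_add_left[OF Pm, of 0 0 x] x R by simp
      then show "\<forall>i\<in>{x} - {y. ?c y \<noteq> 0}. act (?c i) i = 0"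
        by (auto split: if_splits)
    qed (auto split: if_splits)
    then show "x = ?\<pi> ?c"
      using left_module.act_one[OF Pm x] by simp
  qed
  then have "?\<pi> ` ?F = P"
    using \<pi> by (auto simp: left_module_hom_def)
  moreover have "left_module_hom R P act P act (\<lambda>x. x)"
    by (simp add: left_module_hom_def)
  ultimately have "\<exists>s. left_module_hom R P act ?F ?a s \<and> (\<forall>x\<in>P. ?\<pi> (s x) = x)"
    using Pm Fm \<pi>
    by (intro P[unfolded projective_def, THEN conjunct2, rule_format] conjI)
  then obtain s where s: "left_module_hom R P act ?F ?a s" "\<And>x. x \<in> P \<Longrightarrow> ?\<pi> (s x) = x"
    by blast
  have "\<exists>m\<in>M. f m = g x" if "x \<in> P" for x
    using that g f(2) by (force simp: left_module_hom_def)
  then obtain m where m: "\<And>x. x \<in> P \<Longrightarrow> m x \<in> M" "\<And>x. x \<in> P \<Longrightarrow> f (m x) = g x"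
    by metis
  define k where "k = (\<lambda>c. \<Sum>x | c x \<noteq> 0. actM (c x) (m x))"
  have k: "left_module_hom R ?F ?a M actM k"
    unfolding k_def by (rule free_on_eval_hom[OF M]) (use R m in auto)
  have fk: "f (k c) = g (?\<pi> c)" if "c \<in> ?F" for c
  proof -
    let ?S = "{x. c x \<noteq> 0}"
    have c: "finite ?S" "?S \<subseteq> P" "\<And>x. c x \<in> R"
      using that by (auto simp: free_on_def)
    have "f (k c) = (\<Sum>x\<in>?S. f (actM (c x) (m x)))"
      unfolding k_def
      by (rule left_module_hom_sum[OF M N f(1)])
        (use c m in \<open>auto intro!: left_module.act_mem[OF M]\<close>)
    also have "\<dots> = (\<Sum>x\<in>?S. g (act (c x) x))"
    proof (rule sum.cong)
      fix x assume "x \<in> ?S"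
      then have "x \<in> P" using c by auto
      then show "f (actM (c x) (m x)) = g (act (c x) x)"
        using m c f(1) g by (simp add: left_module_hom_def)
    qed simp
    also have "\<dots> = g (?\<pi> c)"
      by (rule left_module_hom_sum[OF Pm N g, symmetric])
        (use c in \<open>auto intro!: left_module.act_mem[OF Pm]\<close>)
    finally show ?thesis .
  qed
  have "left_module_hom R P act M actM (\<lambda>x. k (s x))"
    using s(1) k unfolding left_module_hom_def by (auto simp: image_subset_iff)
  moreover have "\<forall>x\<in>P. f (k (s x)) = g x"
    using fk s by (auto simp: left_module_hom_def image_subset_iff)
  ultimately show ?thesis by blast
qed


section \<open>Hopf \<open>*\<close>-algebras and comodules\<close>

record (overloaded) 'a hopf =
  comult :: "'a \<Rightarrow> 'a \<otimes> 'a"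
  counit :: "'a \<Rightarrow> complex"
  antipode :: "'a \<Rightarrow> 'a"
  star :: "'a \<Rightarrow> 'a"

locale hopf_star_algebra =
  fixes A :: "'a::complex_algebra hopf"
  assumes comult_linear: "clinear (comult A)"
    and counit_linear: "clinear (counit A)"
    and coassoc: "ctensor_assoc (ctensor_map (comult A) (\<lambda>a. a) (comult A a)) =
      ctensor_map (\<lambda>a. a) (comult A) (comult A a)"
    and counit_left: "ctensor_lift (\<lambda>a b. counit A a *\<^sub>C b) (comult A a) = a"
    and counit_right: "ctensor_lift (\<lambda>a b. counit A b *\<^sub>C a) (comult A a) = a"
    and comult_one: "comult A 1 = 1 \<otimes>\<^sub>C 1"
    and comult_mult: "comult A (a * b) = ctensor_map2 (*) (*) (comult A a) (comult A b)"
    and counit_one: "counit A 1 = 1"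
    and counit_mult: "counit A (a * b) = counit A a * counit A b"
    and antipode_linear: "clinear (antipode A)"
    and antipode_left: "ctensor_lift (\<lambda>a b. antipode A a * b) (comult A a) = counit A a *\<^sub>C 1"
    and antipode_right: "ctensor_lift (\<lambda>a b. a * antipode A b) (comult A a) = counit A a *\<^sub>C 1"
    and star_add: "star A (a + b) = star A a + star A b"
    and star_scaleC: "star A (z *\<^sub>C a) = cnj z *\<^sub>C star A a"
    and star_mult: "star A (a * b) = star A b * star A a"
    and star_star: "star A (star A a) = a"
    and comult_star: "comult A (star A a) = ctensor_map (star A) (star A) (comult A a)"
    and counit_star: "counit A (star A a) = cnj (counit A a)"

text \<open>Subalgebras, subbimodules and subcomodules, in particular the degree zero components
  \<open>D\<^sup>0\<close> and \<open>\<XX>\<^sup>0\<close>, are given by a carrier inside the ambient type.  Their structure maps are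
  total functions that are (bi)linear on the ambient type; on the carrier this costs no
  generality, because (bi)linear maps extend from subspaces.  Since tensoring over a field is
  exact, \<open>A \<otimes> V\<close> is the subspace \<open>ctensor_sub V\<close> of the ambient tensor product.\<close>

locale left_comodule =
  fixes A :: "'a::complex_algebra hopf" and V :: "'v::complex_vector set"
    and \<delta> :: "'v \<Rightarrow> 'a \<otimes> 'v"
  assumes subspace: "csubspace V"
    and coact_linear: "clinear \<delta>"
    and coact_mem: "x \<in> V \<Longrightarrow> \<delta> x \<in> ctensor_sub V"
    and coact_coassoc: "x \<in> V \<Longrightarrow>
      ctensor_assoc (ctensor_map (comult A) (\<lambda>x. x) (\<delta> x)) = ctensor_map (\<lambda>a. a) \<delta> (\<delta> x)"
    and coact_counit: "x \<in> V \<Longrightarrow> ctensor_lift (\<lambda>a y. counit A a *\<^sub>C y) (\<delta> x) = x"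

record (overloaded) ('a, 'd) comod_alg =
  alg_carrier :: "'d set"
  alg_coact :: "'d \<Rightarrow> 'a \<otimes> 'd"

locale comodule_algebra =
  left_comodule A "alg_carrier R" "alg_coact R"
  for A :: "'a::complex_algebra hopf" and R :: "('a, 'd::complex_algebra) comod_alg" +
  assumes one_mem: "1 \<in> alg_carrier R"
    and mult_mem: "x \<in> alg_carrier R \<Longrightarrow> y \<in> alg_carrier R \<Longrightarrow> x * y \<in> alg_carrier R"
    and coact_one: "alg_coact R 1 = 1 \<otimes>\<^sub>C 1"
    and coact_mult: "x \<in> alg_carrier R \<Longrightarrow> y \<in> alg_carrier R \<Longrightarrow>
      alg_coact R (x * y) = ctensor_map2 (*) (*) (alg_coact R x) (alg_coact R y)"

record (overloaded) ('a, 'd, 'e, 'x) comod_bimod =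
  bim_carrier :: "'x set"
  bim_lact :: "'d \<Rightarrow> 'x \<Rightarrow> 'x"
  bim_ract :: "'x \<Rightarrow> 'e \<Rightarrow> 'x"
  bim_coact :: "'x \<Rightarrow> 'a \<otimes> 'x"

locale comodule_bimodule =
  R: comodule_algebra A R + S: comodule_algebra A S +
  left_comodule A "bim_carrier M" "bim_coact M" +
  left: left_module "alg_carrier R" "bim_carrier M" "bim_lact M" +
  right: right_module "alg_carrier S" "bim_carrier M" "bim_ract M"
  for A :: "'a::complex_algebra hopf"
    and R :: "('a, 'd::complex_algebra) comod_alg" and S :: "('a, 'e::complex_algebra) comod_alg"
    and M :: "('a, 'd, 'e, 'x::complex_vector) comod_bimod" +
  assumes lact_bilinear: "cbilinear (bim_lact M)"
    and ract_bilinear: "cbilinear (bim_ract M)"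
    and lact_ract: "a \<in> alg_carrier R \<Longrightarrow> x \<in> bim_carrier M \<Longrightarrow> b \<in> alg_carrier S \<Longrightarrow>
      bim_ract M (bim_lact M a x) b = bim_lact M a (bim_ract M x b)"
    and coact_lact: "a \<in> alg_carrier R \<Longrightarrow> x \<in> bim_carrier M \<Longrightarrow>
      bim_coact M (bim_lact M a x) =
        ctensor_map2 (*) (bim_lact M) (alg_coact R a) (bim_coact M x)"
    and coact_ract: "x \<in> bim_carrier M \<Longrightarrow> b \<in> alg_carrier S \<Longrightarrow>
      bim_coact M (bim_ract M x b) =
        ctensor_map2 (*) (bim_ract M) (bim_coact M x) (alg_coact S b)"

definition lproj :: "'a::complex_algebra hopf \<Rightarrow> ('a, 'd::complex_algebra) comod_alg \<Rightarrow>
    ('a, 'e::complex_algebra) comod_alg \<Rightarrow> ('a, 'd, 'e, 'x::complex_vector) comod_bimod set"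
  where "lproj A R S = {M. comodule_bimodule A R S M \<and>
    projective (alg_carrier R) (bim_carrier M) (bim_lact M) \<and>
    (\<exists>G. finite G \<and> G \<subseteq> bim_carrier M \<and>
      left_span (alg_carrier R) (bim_lact M) G = bim_carrier M)}"


section \<open>Comodule dg algebras and dg bimodules\<close>

record (overloaded) ('a, 'd) dg_alg =
  dga_coact :: "'d \<Rightarrow> 'a \<otimes> 'd"
  dga_grade :: "int \<Rightarrow> 'd set"
  dga_diff :: "'d \<Rightarrow> 'd"

definition underlying_alg :: "('a, 'd) dg_alg \<Rightarrow> ('a, 'd) comod_alg"
  where "underlying_alg D = \<lparr>alg_carrier = UNIV, alg_coact = dga_coact D\<rparr>"

definition degree_zero_alg :: "('a, 'd) dg_alg \<Rightarrow> ('a, 'd) comod_alg"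
  where "degree_zero_alg D = \<lparr>alg_carrier = dga_grade D 0, alg_coact = dga_coact D\<rparr>"

text \<open>\<open>koszul_sign i x\<close> is \<open>(-1)\<^sup>i x\<close>.\<close>

definition koszul_sign :: "int \<Rightarrow> 'a::ab_group_add \<Rightarrow> 'a"
  where "koszul_sign i x = (if even i then x else - x)"

locale comodule_dg_algebra =
  comodule_algebra A "underlying_alg D"
  for A :: "'a::complex_algebra hopf" and D :: "('a, 'd::complex_algebra) dg_alg" +
  assumes grading: "graded_by UNIV (dga_grade D)"
    and grade_one: "1 \<in> dga_grade D 0"
    and grade_mult: "x \<in> dga_grade D i \<Longrightarrow> y \<in> dga_grade D j \<Longrightarrow> x * y \<in> dga_grade D (i + j)"
    and diff_linear: "clinear (dga_diff D)"
    and diff_grade: "x \<in> dga_grade D i \<Longrightarrow> dga_diff D x \<in> dga_grade D (i + 1)"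
    and diff_diff: "dga_diff D (dga_diff D x) = 0"
    and diff_mult: "x \<in> dga_grade D i \<Longrightarrow>
      dga_diff D (x * y) = dga_diff D x * y + koszul_sign i (x * dga_diff D y)"
    and coact_grade: "x \<in> dga_grade D i \<Longrightarrow> dga_coact D x \<in> ctensor_sub (dga_grade D i)"
    and coact_diff: "dga_coact D (dga_diff D x) = ctensor_map (\<lambda>a. a) (dga_diff D) (dga_coact D x)"

record (overloaded) ('a, 'd, 'e, 'x) dg_bimod =
  lact :: "'d \<Rightarrow> 'x \<Rightarrow> 'x"
  ract :: "'x \<Rightarrow> 'e \<Rightarrow> 'x"
  coact :: "'x \<Rightarrow> 'a \<otimes> 'x"
  grade :: "int \<Rightarrow> 'x set"
  diff :: "'x \<Rightarrow> 'x"

definition underlying_bimod :: "('a, 'd, 'e, 'x) dg_bimod \<Rightarrow> ('a, 'd, 'e, 'x) comod_bimod"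
  where "underlying_bimod X =
    \<lparr>bim_carrier = UNIV, bim_lact = lact X, bim_ract = ract X, bim_coact = coact X\<rparr>"

definition degree_zero :: "('a, 'd, 'e, 'x) dg_bimod \<Rightarrow> ('a, 'd, 'e, 'x) comod_bimod"
  where "degree_zero X =
    \<lparr>bim_carrier = grade X 0, bim_lact = lact X, bim_ract = ract X, bim_coact = coact X\<rparr>"

locale comodule_dg_bimodule =
  D: comodule_dg_algebra A D + E: comodule_dg_algebra A E +
  comodule_bimodule A "underlying_alg D" "underlying_alg E" "underlying_bimod X"
  for A :: "'a::complex_algebra hopf"
    and D :: "('a, 'd::complex_algebra) dg_alg" and E :: "('a, 'e::complex_algebra) dg_alg"
    and X :: "('a, 'd, 'e, 'x::complex_vector) dg_bimod" +
  assumes grading: "graded_by UNIV (grade X)"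
    and grade_lact: "a \<in> dga_grade D i \<Longrightarrow> x \<in> grade X j \<Longrightarrow> lact X a x \<in> grade X (i + j)"
    and grade_ract: "x \<in> grade X i \<Longrightarrow> b \<in> dga_grade E j \<Longrightarrow> ract X x b \<in> grade X (i + j)"
    and diff_linear: "clinear (diff X)"
    and diff_grade: "x \<in> grade X i \<Longrightarrow> diff X x \<in> grade X (i + 1)"
    and diff_diff: "diff X (diff X x) = 0"
    and diff_lact: "a \<in> dga_grade D i \<Longrightarrow>
      diff X (lact X a x) = lact X (dga_diff D a) x + koszul_sign i (lact X a (diff X x))"
    and diff_ract: "x \<in> grade X i \<Longrightarrow>
      diff X (ract X x b) = ract X (diff X x) b + koszul_sign i (ract X x (dga_diff E b))"
    and coact_grade: "x \<in> grade X i \<Longrightarrow> coact X x \<in> ctensor_sub (grade X i)"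
    and coact_diff: "coact X (diff X x) = ctensor_map (\<lambda>a. a) (diff X) (coact X x)"

definition dg_Mod :: "'a::complex_algebra hopf \<Rightarrow> ('a, 'd::complex_algebra) dg_alg \<Rightarrow>
    ('a, 'e::complex_algebra) dg_alg \<Rightarrow> ('a, 'd, 'e, 'x::complex_vector) dg_bimod set"
  where "dg_Mod A D E = {X. comodule_dg_bimodule A D E X}"

definition dg0_lproj :: "'a::complex_algebra hopf \<Rightarrow> ('a, 'd::complex_algebra) dg_alg \<Rightarrow>
    ('a, 'e::complex_algebra) dg_alg \<Rightarrow> ('a, 'd, 'e, 'x::complex_vector) dg_bimod set"
  where "dg0_lproj A D E = {X \<in> dg_Mod A D E. projective UNIV UNIV (lact X) \<and>
    (\<exists>G. finite G \<and> G \<subseteq> grade X 0 \<and> left_span UNIV (lact X) G = UNIV)}"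


subsection \<open>The multiplication map\<close>

text \<open>The tensor product of \<open>D\<close> and \<open>\<XX>\<^sup>0\<close> over \<open>D\<^sup>0\<close> with its left \<open>D\<close>-action and right
  \<open>E\<^sup>0\<close>-action.\<close>

definition tens0_rels :: "('a, 'd::complex_algebra) dg_alg \<Rightarrow>
    ('a, 'd, 'e, 'x::complex_vector) dg_bimod \<Rightarrow> ('d \<times> 'x \<Rightarrow>\<^sub>0 int) set"
  where "tens0_rels D X = tensor_rels (dga_grade D 0) UNIV (grade X 0) (*) (lact X)"

definition tens0_carrier :: "('a, 'd::complex_algebra) dg_alg \<Rightarrow>
    ('a, 'd, 'e, 'x::complex_vector) dg_bimod \<Rightarrow> ('d \<times> 'x \<Rightarrow>\<^sub>0 int) set set"
  where "tens0_carrier D X = tensor_carrier (dga_grade D 0) UNIV (grade X 0) (*) (lact X)"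

definition tens0_lact :: "('a, 'd::complex_algebra) dg_alg \<Rightarrow>
    ('a, 'd, 'e, 'x::complex_vector) dg_bimod \<Rightarrow> 'd \<Rightarrow> ('d \<times> 'x \<Rightarrow>\<^sub>0 int) set \<Rightarrow>
    ('d \<times> 'x \<Rightarrow>\<^sub>0 int) set"
  where "tens0_lact D X a = coset_map (tens0_rels D X) (\<lambda>(d, x). (a * d, x))"

definition tens0_ract :: "('a, 'd::complex_algebra) dg_alg \<Rightarrow>
    ('a, 'd, 'e, 'x::complex_vector) dg_bimod \<Rightarrow> ('d \<times> 'x \<Rightarrow>\<^sub>0 int) set \<Rightarrow> 'e \<Rightarrow>
    ('d \<times> 'x \<Rightarrow>\<^sub>0 int) set"
  where "tens0_ract D X S e = coset_map (tens0_rels D X) (\<lambda>(d, x). (d, ract X x e)) S"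

text \<open>The map \<open>\<mu>\<close> with \<open>\<mu> (d \<otimes> x) = d x\<close>; see \<open>coset_eval_class\<close>.\<close>

definition mult_map :: "('a, 'd, 'e, 'x::complex_vector) dg_bimod \<Rightarrow>
    ('d \<times> 'x \<Rightarrow>\<^sub>0 int) set \<Rightarrow> 'x"
  where "mult_map X = coset_eval (lact X)"

definition mult_map_iso :: "('a, 'd::complex_algebra) dg_alg \<Rightarrow> ('a, 'e) dg_alg \<Rightarrow>
    ('a, 'd, 'e, 'x::complex_vector) dg_bimod \<Rightarrow> bool"
  where "mult_map_iso D E X \<longleftrightarrow>
    bij_betw (mult_map X) (tens0_carrier D X) UNIV \<and>
    (\<forall>S\<in>tens0_carrier D X. \<forall>T\<in>tens0_carrier D X.
      mult_map X (coset_add S T) = mult_map X S + mult_map X T) \<and>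
    (\<forall>a. \<forall>S\<in>tens0_carrier D X. mult_map X (tens0_lact D X a S) = lact X a (mult_map X S)) \<and>
    (\<forall>S\<in>tens0_carrier D X. \<forall>e\<in>dga_grade E 0.
      mult_map X (tens0_ract D X S e) = ract X (mult_map X S) e)"


subsection \<open>Graded direct summands of free modules\<close>

definition free_power :: "nat \<Rightarrow> (nat \<Rightarrow> 'd::zero) set"
  where "free_power m = {c. \<forall>i\<ge>m. c i = 0}"

definition free_power_grade :: "('a, 'd::zero) dg_alg \<Rightarrow> nat \<Rightarrow> int \<Rightarrow> (nat \<Rightarrow> 'd) set"
  where "free_power_grade D m k = {c \<in> free_power m. \<forall>i. c i \<in> dga_grade D k}"

definition free_power_lact :: "'d::times \<Rightarrow> (nat \<Rightarrow> 'd) \<Rightarrow> nat \<Rightarrow> 'd"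
  where "free_power_lact a c = (\<lambda>i. a * c i)"

definition graded_submodule_free_power ::
    "('a, 'd::complex_algebra) dg_alg \<Rightarrow> nat \<Rightarrow> (nat \<Rightarrow> 'd) set \<Rightarrow> bool"
  where "graded_submodule_free_power D m P \<longleftrightarrow> P \<subseteq> free_power m \<and>
    left_module UNIV P free_power_lact \<and> graded_by P (\<lambda>k. P \<inter> free_power_grade D m k)"

text \<open>\<open>D\<^sup>\<oplus>\<^sup>m = P \<oplus> Q\<close> as graded left \<open>D\<close>-modules, with \<open>f\<close> a degree preserving isomorphism of
  \<open>\<XX>\<close> onto \<open>P\<close>.  No degree shifts occur.\<close>

definition graded_summand_of_free_power :: "('a, 'd::complex_algebra) dg_alg \<Rightarrow>
    ('a, 'd, 'e, 'x::complex_vector) dg_bimod \<Rightarrow> nat \<Rightarrow> bool"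
  where "graded_summand_of_free_power D X m \<longleftrightarrow>
    (\<exists>P Q f. graded_submodule_free_power D m P \<and> graded_submodule_free_power D m Q \<and>
      P \<inter> Q = {0} \<and> {p + q | p q. p \<in> P \<and> q \<in> Q} = free_power m \<and>
      left_module_hom UNIV UNIV (lact X) P free_power_lact f \<and> bij_betw f UNIV P \<and>
      (\<forall>k. f ` grade X k = P \<inter> free_power_grade D m k))"

end

theory Submission
  imports Defs
begin

text \<open>
  All three conditions say that \<open>\<XX>\<close> has a \<^emph>\<open>graded dual basis\<close> over \<open>D\<close>: finitely many elements
  \<open>g\<^sub>1, \<dots>, g\<^sub>n\<close> of degree zero and degree preserving left \<open>D\<close>-linear functionals
  \<open>\<phi>\<^sub>1, \<dots>, \<phi>\<^sub>n : \<XX> \<rightarrow> D\<close> with \<open>x = \<Sum>\<^sub>i \<phi>\<^sub>i(x) g\<^sub>i\<close> for all \<open>x\<close>.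
  The comodule and bimodule structures restrict to degree zero and \<open>\<mu>\<close> respects both actions, so
  each condition amounts to a statement about left modules.

  \<^item> An ungraded dual basis is the same as projectivity together with a finite generating set
    (\<open>projective_imp_dual_basis\<close>, \<open>dual_basis_imp_projective\<close>).  If the generators have degree zero,
    the functionals may be replaced by their degree zero parts, because the expansion of a
    homogeneous \<open>x\<close> can be read off in the degree of \<open>x\<close> (\<open>dual_basis_imp_graded\<close>).

  \<^item> A graded dual basis restricts to a dual basis of \<open>\<XX>\<^sup>0\<close> over \<open>D\<^sup>0\<close>.  Expanding the right factors in
    it gives \<open>t = \<Sum>\<^sub>i \<phi>\<^sub>i(\<mu> t) \<otimes> g\<^sub>i\<close> for each \<open>t\<close> in \<open>D \<otimes> \<XX>\<^sup>0\<close>, hence \<open>\<mu>\<close> is injective; it is surjective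
    because the \<open>g\<^sub>i\<close> generate (\<open>graded_dual_basis_imp_mult_map_bij\<close>).  Conversely, if \<open>\<mu>\<close> is bijective,
    a functional \<open>\<psi>\<close> on \<open>\<XX>\<^sup>0\<close> extends to \<open>\<XX>\<close> as \<open>d \<otimes> y \<mapsto> d \<psi>(y)\<close> composed with the inverse of \<open>\<mu>\<close>
    (\<open>mult_map_bij_imp_graded_dual_basis\<close>).

  \<^item> The functionals of a graded dual basis are the coordinates of an embedding of \<open>\<XX>\<close> into \<open>D\<^sup>n\<close>,
    which is split by the map sending the standard basis to the \<open>g\<^sub>i\<close>; and a split embedding gives back
    functionals and generators (\<open>graded_dual_basis_imp_summand\<close>, \<open>summand_imp_graded_dual_basis\<close>).
\<close>

section \<open>Graded vector spaces\<close>

text \<open>Degree \<open>k\<close> component of \<open>x\<close>.  The carrier of the graded space is not a parameter, because the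
  components of \<open>x\<close> are determined by the homogeneous subspaces.\<close>

definition hcomp :: "(int \<Rightarrow> 'v::complex_vector set) \<Rightarrow> int \<Rightarrow> 'v \<Rightarrow> 'v"
  where "hcomp G k x =
    (THE c. finite {i. c i \<noteq> 0} \<and> (\<forall>i. c i \<in> G i) \<and> x = (\<Sum>i | c i \<noteq> 0. c i)) k"

locale graded_space =
  fixes V :: "'v::complex_vector set" and G :: "int \<Rightarrow> 'v set"
  assumes graded: "graded_by V G"
begin

lemma grade_sub: "csubspace (G i)"
  and grade_subset: "G i \<subseteq> V"
  and space_sub: "csubspace V"
  using graded by (auto simp: graded_by_def)

lemma grade_zero: "0 \<in> G i"
  by (rule complex_vector.subspace_0[OF grade_sub])

lemma hcomp_props:
  assumes "x \<in> V"
  shows "finite {i. hcomp G i x \<noteq> 0}" "hcomp G i x \<in> G i"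
    "x = (\<Sum>i | hcomp G i x \<noteq> 0. hcomp G i x)"
proof -
  have "\<exists>!c. finite {i. c i \<noteq> 0} \<and> (\<forall>i. c i \<in> G i) \<and> x = (\<Sum>i | c i \<noteq> 0. c i)"
    using graded assms by (simp add: graded_by_def)
  from theI'[OF this] show "finite {i. hcomp G i x \<noteq> 0}" "hcomp G i x \<in> G i"
    "x = (\<Sum>i | hcomp G i x \<noteq> 0. hcomp G i x)"
    unfolding hcomp_def by auto
qed

lemma hcomp_unique:
  assumes "x \<in> V" "finite S" "\<And>i. c i \<in> G i" "\<And>i. i \<notin> S \<Longrightarrow> c i = 0" "x = (\<Sum>i\<in>S. c i)"
  shows "hcomp G i x = c i"
proof -
  let ?Q = "\<lambda>c. finite {i. c i \<noteq> 0} \<and> (\<forall>i. c i \<in> G i) \<and> x = (\<Sum>i | c i \<noteq> 0. c i)"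
  have "\<exists>!c. ?Q c"
    using graded assms by (simp add: graded_by_def)
  moreover have "?Q c"
  proof (intro conjI allI)
    show "finite {i. c i \<noteq> 0}"
      by (rule finite_subset[OF _ assms(2)]) (use assms(4) in auto)
    show "x = (\<Sum>i | c i \<noteq> 0. c i)"
      unfolding assms(5) by (rule sum.mono_neutral_right) (use assms(2,4) in auto)
  qed (rule assms(3))
  ultimately have "(THE c. ?Q c) = c"
    by (rule the1_equality[where P = ?Q])
  then show ?thesis
    by (simp add: hcomp_def)
qed

lemma hcomp_sum_superset:
  assumes "x \<in> V" "finite S" "{i. hcomp G i x \<noteq> 0} \<subseteq> S"
  shows "x = (\<Sum>i\<in>S. hcomp G i x)"
proof -
  have "x = (\<Sum>i | hcomp G i x \<noteq> 0. hcomp G i x)"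
    by (rule hcomp_props(3)[OF assms(1)])
  also have "\<dots> = (\<Sum>i\<in>S. hcomp G i x)"
    by (rule sum.mono_neutral_left) (use assms in auto)
  finally show ?thesis .
qed

lemma hcomp_homogeneous:
  assumes "x \<in> G j"
  shows "hcomp G k x = (if k = j then x else 0)"
  by (rule hcomp_unique[where S = "{j}"]) (use assms grade_subset grade_zero in auto)

lemma hcomp_add:
  assumes "x \<in> V" "y \<in> V"
  shows "hcomp G k (x + y) = hcomp G k x + hcomp G k y"
proof (rule hcomp_unique)
  let ?S = "{i. hcomp G i x \<noteq> 0} \<union> {i. hcomp G i y \<noteq> 0}"
  show "finite ?S"
    using hcomp_props(1) assms by simp
  show "x + y = (\<Sum>i\<in>?S. hcomp G i x + hcomp G i y)"
    using hcomp_sum_superset[OF assms(1) \<open>finite ?S\<close>] hcomp_sum_superset[OF assms(2) \<open>finite ?S\<close>]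
    by (simp add: sum.distrib)
  show "x + y \<in> V"
    using assms space_sub by (rule complex_vector.subspace_add[rotated])
  show "hcomp G i x + hcomp G i y \<in> G i" for i
    using hcomp_props(2) assms grade_sub complex_vector.subspace_add by blast
qed auto

lemma hcomp_0: "hcomp G k 0 = 0"
  using hcomp_homogeneous[OF grade_zero] by simp

text \<open>An identity between additive expressions only has to be checked on homogeneous elements.  This
  replaces almost all computations with sums of components.\<close>

lemma graded_induct [consumes 1, case_names homogeneous add]:
  assumes "x \<in> V"
    and hom: "\<And>k y. y \<in> G k \<Longrightarrow> P y"
    and add: "\<And>y z. y \<in> V \<Longrightarrow> z \<in> V \<Longrightarrow> P y \<Longrightarrow> P z \<Longrightarrow> P (y + z)"
  shows "P x"
proof -
  have "P (\<Sum>i\<in>S. hcomp G i x) \<and> (\<Sum>i\<in>S. hcomp G i x) \<in> V" if "finite S" for S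
    using that
  proof induction
    case empty
    then show ?case using hom[OF grade_zero] grade_zero grade_subset by auto
  next
    case (insert i S)
    have "hcomp G i x \<in> G i" by (rule hcomp_props(2)[OF assms(1)])
    then have "P (hcomp G i x)" "hcomp G i x \<in> V" using hom grade_subset by auto
    with insert show ?case
      by (simp add: add complex_vector.subspace_add[OF space_sub])
  qed
  from this[OF hcomp_props(1)[OF assms(1)]] show ?thesis
    using hcomp_props(3)[OF assms(1)] by simp
qed

lemma homogeneousI: "x \<in> V \<Longrightarrow> hcomp G k x = x \<Longrightarrow> x \<in> G k"
  using hcomp_props(2)[of x k] by simp

end

section \<open>Dual bases of finitely generated projective modules\<close>

definition subring :: "'r::{ring,monoid_mult} set \<Rightarrow> bool"
  where "subring R \<longleftrightarrow> 0 \<in> R \<and> 1 \<in> R \<and> (\<forall>r\<in>R. \<forall>s\<in>R. r - s \<in> R \<and> r * s \<in> R)"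

text \<open>The functionals are total functions of which only the values on \<open>M\<close> matter, and repetitions among
  the generators are allowed, since a projection of a free module may identify basis vectors.\<close>

definition dual_basis :: "'r::{ring,monoid_mult} set \<Rightarrow> 'm::ab_group_add set \<Rightarrow>
    ('r \<Rightarrow> 'm \<Rightarrow> 'm) \<Rightarrow> nat \<Rightarrow> (nat \<Rightarrow> 'm) \<Rightarrow> (nat \<Rightarrow> 'm \<Rightarrow> 'r) \<Rightarrow> bool"
  where "dual_basis R M act n g \<phi> \<longleftrightarrow>
    (\<forall>i<n. g i \<in> M \<and> left_module_hom R M act R (*) (\<phi> i)) \<and>
    (\<forall>x\<in>M. (\<Sum>i<n. act (\<phi> i x) (g i)) = x)"

lemma left_module_add_mem:
  assumes "left_module R M act" "x \<in> M" "y \<in> M"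
  shows "x + y \<in> M"
proof -
  interpret left_module R M act by fact
  show ?thesis
    using diff_mem[OF assms(2) diff_mem[OF zero_mem assms(3)]] by simp
qed

lemma left_module_act_zero:
  assumes "left_module R M act" "r \<in> R"
  shows "act r 0 = 0"
  using left_module.act_add_right[OF assms, of 0 0] left_module.zero_mem[OF assms(1)] by simp

lemma left_module_zero_act:
  assumes "left_module R M act" "0 \<in> R" "x \<in> M"
  shows "act 0 x = 0"
  using left_module.act_add_left[OF assms(1), of 0 0 x] assms(2,3) by simp

lemma left_module_act_sum:
  assumes "left_module R M act" "r \<in> R" "finite S" "\<And>i. i \<in> S \<Longrightarrow> f i \<in> M"
  shows "act r (sum f S) = (\<Sum>i\<in>S. act r (f i))"
  using assms(3,4)
proof induction
  case empty
  show ?case using left_module_act_zero[OF assms(1,2)] by simp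
next
  case (insert i S)
  then show ?case
    using left_module.act_add_right[OF assms(1,2)] left_module_sum_mem[OF assms(1), of S f] by simp
qed

lemma left_module_sum_act:
  assumes "left_module R M act" "0 \<in> R" "\<And>r s. r \<in> R \<Longrightarrow> s \<in> R \<Longrightarrow> r + s \<in> R"
    "finite S" "\<And>i. i \<in> S \<Longrightarrow> c i \<in> R" "x \<in> M"
  shows "act (sum c S) x = (\<Sum>i\<in>S. act (c i) x)"
proof -
  have "sum c S \<in> R \<and> act (sum c S) x = (\<Sum>i\<in>S. act (c i) x)"
    using assms(4,5)
    by induction (auto simp: left_module_zero_act[OF assms(1,2,6)] assms(2,3,6)
      left_module.act_add_left[OF assms(1)])
  then show ?thesis by simp
qed

lemma subring_regular_module:
  assumes "subring R"
  shows "left_module R R (*)"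
  using assms by unfold_locales (auto simp: subring_def algebra_simps)

text \<open>Used both for the coordinates of a free module, where it gives the map sending the standard
  basis to \<open>y\<close>, and for the functionals of a dual basis, where it gives the lift of a homomorphism
  whose values on the generators are lifted to \<open>y\<close>.\<close>

lemma sum_functionals_hom:
  fixes n :: nat
  assumes M: "left_module R M act" and N: "left_module R N actN" and R: "subring R"
    and \<phi>: "\<And>i. i < n \<Longrightarrow> left_module_hom R M act R (*) (\<phi> i)"
    and y: "\<And>i. i < n \<Longrightarrow> y i \<in> N"
  shows "left_module_hom R M act N actN (\<lambda>x. \<Sum>i<n. actN (\<phi> i x) (y i))"
proof -
  have \<phi>R: "\<phi> i x \<in> R" if "i < n" "x \<in> M" for i x
    using \<phi>[OF that(1)] that(2) by (auto simp: left_module_hom_def)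
  have mem: "actN (\<phi> i x) (y i) \<in> N" if "i < n" "x \<in> M" for i x
    using \<phi>R y that by (simp add: left_module.act_mem[OF N])
  have "actN (\<phi> i (x + x')) (y i) = actN (\<phi> i x) (y i) + actN (\<phi> i x') (y i)"
    if "i < n" "x \<in> M" "x' \<in> M" for i x x'
    using \<phi>[OF that(1)] that \<phi>R y
    by (simp add: left_module_hom_def left_module.act_add_left[OF N])
  moreover have "actN (\<phi> i (act r x)) (y i) = actN r (actN (\<phi> i x) (y i))"
    if "i < n" "x \<in> M" "r \<in> R" for i x r
    using \<phi>[OF that(1)] that \<phi>R y
    by (simp add: left_module_hom_def left_module.act_act[OF N])
  moreover have "actN r (\<Sum>i<n. actN (\<phi> i x) (y i)) = (\<Sum>i<n. actN r (actN (\<phi> i x) (y i)))"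
    if "x \<in> M" "r \<in> R" for x r
    by (rule left_module_act_sum[OF N]) (use that mem in auto)
  ultimately show ?thesis
    using mem unfolding left_module_hom_def
    by (auto simp: sum.distrib[symmetric] intro!: left_module_sum_mem[OF N])
qed

text \<open>Lift the identity along the surjection from a free module of finite rank: the coordinates
  of the section are the functionals.\<close>

lemma projective_imp_dual_basis:
  fixes R :: "'r::{ring,monoid_mult} set" and M :: "'m::ab_group_add set"
  assumes R: "subring R" and P: "projective R M act"
    and G: "finite G" "G \<subseteq> M" "left_span R act G = M"
  shows "\<exists>n g \<phi>. g ` {..<n} = G \<and> dual_basis R M act n g \<phi>"
proof -
  have M: "left_module R M act"
    using P by (simp add: projective_def)
  have R': "0 \<in> R" "1 \<in> R" "\<And>r s. r \<in> R \<Longrightarrow> s \<in> R \<Longrightarrow> r - s \<in> R"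
    "\<And>r s. r \<in> R \<Longrightarrow> s \<in> R \<Longrightarrow> r * s \<in> R"
    using R by (auto simp: subring_def)
  obtain g :: "nat \<Rightarrow> 'm" where g: "bij_betw g {..<card G} G"
    using ex_bij_betw_nat_finite[OF G(1)] by (auto simp: lessThan_atLeast0)
  define n where "n = card G"
  have gM: "g i \<in> M" if "i < n" for i
    using g that G(2) by (auto simp: bij_betw_def n_def)
  let ?F = "free_on R {..<n}" and ?a = "\<lambda>(r::'r) (c::nat \<Rightarrow> 'r) i. r * c i"
  let ?e = "\<lambda>c. \<Sum>i<n. act (c i) (g i)"
  have F: "left_module R ?F ?a"
    by (rule left_module_free_on) (use R' in auto)
  have coord: "left_module_hom R ?F ?a R (*) (\<lambda>c. c i)" for i
    by (auto simp: left_module_hom_def free_on_def)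
  have e: "left_module_hom R ?F ?a M act ?e"
    by (rule sum_functionals_hom[OF F M R, of n "\<lambda>i c. c i"]) (use coord gM in auto)
  have "x \<in> ?e ` ?F" if "x \<in> M" for x
  proof -
    from that G(3) obtain c T where T: "x = (\<Sum>y\<in>T. act (c y) y)" "T \<subseteq> G" "\<forall>y\<in>T. c y \<in> R"
      by (auto simp: left_span_def)
    define b where "b = (\<lambda>i. if i < n \<and> g i \<in> T then c (g i) else 0)"
    have "b \<in> ?F"
      using T(3) R' by (auto simp: b_def free_on_def intro: finite_subset[of _ "{..<n}"])
    have "?e b = (\<Sum>i<n. (\<lambda>y. if y \<in> T then act (c y) y else 0) (g i))"
      by (rule sum.cong) (auto simp: b_def left_module_zero_act[OF M R'(1)] gM)
    also have "\<dots> = (\<Sum>y\<in>G. if y \<in> T then act (c y) y else 0)"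
      using g unfolding n_def by (rule sum.reindex_bij_betw)
    also have "\<dots> = x"
      unfolding T(1) using G(1) T(2) by (simp add: sum.If_cases Int_absorb1)
    finally show ?thesis
      using \<open>b \<in> ?F\<close> by blast
  qed
  then have "?e ` ?F = M"
    using e by (auto simp: left_module_hom_def)
  moreover have "left_module_hom R M act M act (\<lambda>x. x)"
    by (simp add: left_module_hom_def)
  ultimately obtain s where s: "left_module_hom R M act ?F ?a s" "\<And>x. x \<in> M \<Longrightarrow> ?e (s x) = x"
    using projective_lifts[OF R' P F M e] by blast
  have "left_module_hom R M act R (*) (\<lambda>x. s x i)" for i
    using s(1) by (auto simp: left_module_hom_def free_on_def image_subset_iff)
  then have "dual_basis R M act n g (\<lambda>i x. s x i)"
    using gM s(2) by (simp add: dual_basis_def)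
  moreover have "g ` {..<n} = G"
    using g by (simp add: bij_betw_def n_def)
  ultimately show ?thesis
    by blast
qed

text \<open>To lift a homomorphism along a surjection, choose preimages \<open>l i\<close> of its values on the
  generators and send \<open>x\<close> to \<open>\<Sum>i. \<phi> i x * l i\<close>.\<close>

lemma dual_basis_imp_projective:
  assumes R: "subring R" and M: "left_module R M act" and db: "dual_basis R M act n g \<phi>"
  shows "projective R M act"
  unfolding projective_def
proof (intro conjI M allI impI, elim conjE)
  fix L :: "('b \<Rightarrow> 'a) set" and actL and N :: "'b set" and actN f h
  assume L: "left_module R L actL" and N: "left_module R N actN"
    and f: "left_module_hom R L actL N actN f" "f ` L = N"
    and h: "left_module_hom R M act N actN h"
  have g: "\<And>i. i < n \<Longrightarrow> g i \<in> M"
    and \<phi>: "\<And>i. i < n \<Longrightarrow> left_module_hom R M act R (*) (\<phi> i)"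
    and x: "\<And>x. x \<in> M \<Longrightarrow> (\<Sum>i<n. act (\<phi> i x) (g i)) = x"
    using db by (auto simp: dual_basis_def)
  have "\<exists>l\<in>L. f l = h (g i)" if "i < n" for i
    using f(2) h g[OF that] by (force simp: left_module_hom_def)
  then obtain l where l: "\<And>i. i < n \<Longrightarrow> l i \<in> L" "\<And>i. i < n \<Longrightarrow> f (l i) = h (g i)"
    by metis
  have \<phi>R: "\<phi> i x \<in> R" if "i < n" "x \<in> M" for i x
    using \<phi>[OF that(1)] that(2) by (auto simp: left_module_hom_def)
  let ?k = "\<lambda>x. \<Sum>i<n. actL (\<phi> i x) (l i)"
  have "left_module_hom R M act L actL ?k"
    by (rule sum_functionals_hom[OF M L R \<phi> l(1)])
  moreover have "f (?k x) = h x" if "x \<in> M" for x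
  proof -
    have "f (?k x) = (\<Sum>i<n. f (actL (\<phi> i x) (l i)))"
      by (rule left_module_hom_sum[OF L N f(1)])
        (use that l \<phi>R in \<open>auto intro!: left_module.act_mem[OF L]\<close>)
    also have "\<dots> = (\<Sum>i<n. h (act (\<phi> i x) (g i)))"
      using f(1) h l \<phi>R g that by (intro sum.cong) (auto simp: left_module_hom_def)
    also have "\<dots> = h (\<Sum>i<n. act (\<phi> i x) (g i))"
      by (rule left_module_hom_sum[OF M N h, symmetric])
        (use that g \<phi>R in \<open>auto intro!: left_module.act_mem[OF M]\<close>)
    finally show ?thesis
      using x[OF that] by simp
  qed
  ultimately show "\<exists>k. left_module_hom R M act L actL k \<and> (\<forall>x\<in>M. f (k x) = h x)"
    by blast
qed

lemma dual_basis_imp_span: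
  assumes R: "subring R" and M: "left_module R M act" and db: "dual_basis R M act n g \<phi>"
  shows "left_span R act (g ` {..<n}) = M"
proof
  have g: "\<And>i. i < n \<Longrightarrow> g i \<in> M" using db by (auto simp: dual_basis_def)
  show "left_span R act (g ` {..<n}) \<subseteq> M"
    unfolding left_span_def
    using g by (fastforce intro!: left_module_sum_mem[OF M] left_module.act_mem[OF M])
  show "M \<subseteq> left_span R act (g ` {..<n})"
  proof
    fix x assume x: "x \<in> M"
    have \<phi>R: "\<phi> i x \<in> R" if "i < n" for i
      using db x that by (auto simp: dual_basis_def left_module_hom_def image_subset_iff)
    have addR: "\<And>r s. r \<in> R \<Longrightarrow> s \<in> R \<Longrightarrow> r + s \<in> R"
      by (rule left_module_add_mem[OF subring_regular_module[OF R]])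
    have zR: "0 \<in> R" using R by (simp add: subring_def)
    \<comment> \<open>The span is indexed by the set of generators, so coefficients of equal generators are collected.\<close>
    define c where "c = (\<lambda>y. \<Sum>i\<in>{i\<in>{..<n}. g i = y}. \<phi> i x)"
    have "x = (\<Sum>i<n. act (\<phi> i x) (g i))"
      using db x by (simp add: dual_basis_def)
    also have "\<dots> = (\<Sum>y\<in>g ` {..<n}. \<Sum>i\<in>{i\<in>{..<n}. g i = y}. act (\<phi> i x) (g i))"
      by (rule sum.image_gen) simp
    also have "\<dots> = (\<Sum>y\<in>g ` {..<n}. act (c y) y)"
    proof (rule sum.cong)
      fix y assume "y \<in> g ` {..<n}"
      then have "y \<in> M" using g by auto
      then have "act (c y) y = (\<Sum>i\<in>{i\<in>{..<n}. g i = y}. act (\<phi> i x) y)"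
        unfolding c_def using \<phi>R
        by (intro left_module_sum_act[OF M zR addR]) auto
      then show "(\<Sum>i\<in>{i\<in>{..<n}. g i = y}. act (\<phi> i x) (g i)) = act (c y) y"
        by (auto intro: sum.cong)
    qed simp
    finally have "x = (\<Sum>y\<in>g ` {..<n}. act (c y) y)" .
    moreover have "c y \<in> R" for y
      unfolding c_def
      by (rule left_module_sum_mem[OF subring_regular_module[OF R]]) (use \<phi>R in auto)
    ultimately show "x \<in> left_span R act (g ` {..<n})"
      unfolding left_span_def by blast
  qed
qed

section \<open>Balanced tensors\<close>

abbreviation frag_map :: "('p \<Rightarrow> 'q) \<Rightarrow> ('p \<Rightarrow>\<^sub>0 int) \<Rightarrow> ('q \<Rightarrow>\<^sub>0 int)"
  where "frag_map h \<equiv> frag_extend (\<lambda>p. frag_of (h p))"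

text \<open>Evaluation is determined by its values on generators, so an identity \<open>f \<circ> h = L \<circ> f'\<close> on the
  generators that occur in \<open>u\<close> propagates to \<open>u\<close>.\<close>

lemma frag_eval_frag_map:
  assumes "Poly_Mapping.keys u \<subseteq> S"
    and add: "\<And>v w. L (v - w) = L v - L w"
    and h: "\<And>m n. (m, n) \<in> S \<Longrightarrow> f (fst (h (m, n))) (snd (h (m, n))) = L (f' m n)"
  shows "frag_eval f (frag_map h u) = L (frag_eval f' u)"
  using assms(1)
proof (induction u rule: frag_induction)
  case zero
  show ?case using add[of 0 0] by simp
next
  case (one p)
  then show ?case
    using h[of "fst p" "snd p"] frag_eval_of[of f "fst (h p)" "snd (h p)"]
      frag_eval_of[of f' "fst p" "snd p"] by simp
next
  case (diff v w)
  then show ?case by (simp add: frag_extend_diff frag_eval_diff add)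
qed

lemma keys_frag_map:
  "Poly_Mapping.keys (frag_map h u) \<subseteq> h ` Poly_Mapping.keys u"
  using keys_frag_extend[of "\<lambda>p. frag_of (h p)" u] by auto

lemma tensor_rels_sum:
  assumes "finite S" "\<And>i. i \<in> S \<Longrightarrow> u i \<in> tensor_rels R M N ra la"
  shows "sum u S \<in> tensor_rels R M N ra la"
  using assms by (induction S rule: finite_induct) (auto intro: tensor_rels.zero tensor_rels_add)

lemma tensor_rels_sum_right:
  assumes N: "left_module R N la" and m: "m \<in> M" and "finite S" "\<And>i. i \<in> S \<Longrightarrow> y i \<in> N"
  shows "frag_of (m, \<Sum>i\<in>S. y i) - (\<Sum>i\<in>S. frag_of (m, y i)) \<in> tensor_rels R M N ra la"
  using assms(3,4)
proof (induction S rule: finite_induct)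
  case empty
  have "frag_of (m, 0 + 0) - frag_of (m, 0) - frag_of (m, 0) \<in> tensor_rels R M N ra la"
    using m left_module.zero_mem[OF N] by (intro tensor_rels.add_right) auto
  from tensor_rels_uminus[OF this] show ?case by simp
next
  case (insert i S)
  have "sum y S \<in> N"
    by (rule left_module_sum_mem[OF N]) (use insert in auto)
  then have "frag_of (m, y i + sum y S) - frag_of (m, y i) - frag_of (m, sum y S)
      \<in> tensor_rels R M N ra la"
    using insert m by (intro tensor_rels.add_right) auto
  moreover have "frag_of (m, sum y S) - (\<Sum>i\<in>S. frag_of (m, y i)) \<in> tensor_rels R M N ra la"
    using insert by simp
  ultimately have "(frag_of (m, y i + sum y S) - frag_of (m, y i) - frag_of (m, sum y S)) +
      (frag_of (m, sum y S) - (\<Sum>i\<in>S. frag_of (m, y i))) \<in> tensor_rels R M N ra la"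
    by (rule tensor_rels_add)
  then show ?case
    using insert by (simp add: algebra_simps)
qed

text \<open>Expand the right factor of each elementary tensor in the dual basis and move the
  coefficients across the tensor sign.\<close>

lemma tensor_dual_basis_expansion:
  fixes N :: "'n::ab_group_add set" and R :: "'r::complex_algebra set"
  assumes N: "left_module R N la" and db: "dual_basis R N la n g \<psi>"
    and u: "Poly_Mapping.keys u \<subseteq> UNIV \<times> N"
  shows "u - (\<Sum>i<n. frag_of (frag_eval (\<lambda>d x. d * \<psi> i x) u, g i))
    \<in> tensor_rels R UNIV N (*) la" (is "_ \<in> ?K")
proof -
  have g: "\<And>i. i < n \<Longrightarrow> g i \<in> N" and \<psi>: "\<And>i x. i < n \<Longrightarrow> x \<in> N \<Longrightarrow> \<psi> i x \<in> R"
    and x: "\<And>x. x \<in> N \<Longrightarrow> (\<Sum>i<n. la (\<psi> i x) (g i)) = x"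
    using db by (auto simp: dual_basis_def left_module_hom_def image_subset_iff)
  have add: "frag_of (a + b, g i) - frag_of (a, g i) - frag_of (b, g i) \<in> ?K" if "i < n" for a b i
    using g[OF that] by (intro tensor_rels.add_left) auto
  show ?thesis
    using u
  proof (induction u rule: frag_induction)
    case zero
    \<comment> \<open>Additivity at \<open>0 + 0\<close> makes \<open>0 \<otimes> g i\<close> a relation.\<close>
    have "- (frag_of (0 + 0, g i) - frag_of (0, g i) - frag_of (0, g i)) \<in> ?K" if "i < n" for i
      by (rule tensor_rels_uminus, rule add, rule that)
    then have "(\<Sum>i<n. frag_of (0, g i)) \<in> ?K"
      by (intro tensor_rels_sum) auto
    from tensor_rels_uminus[OF this] show ?case by simp
  next
    case (one p)
    obtain d y where p: "p = (d, y)" and y: "y \<in> N"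
      using one by auto
    have "frag_of (d, \<Sum>i<n. la (\<psi> i y) (g i)) - (\<Sum>i<n. frag_of (d, la (\<psi> i y) (g i))) \<in> ?K"
      by (rule tensor_rels_sum_right[OF N])
        (use y g \<psi> in \<open>auto intro: left_module.act_mem[OF N]\<close>)
    moreover have "(\<Sum>i<n. frag_of (d * \<psi> i y, g i) - frag_of (d, la (\<psi> i y) (g i))) \<in> ?K"
      by (intro tensor_rels_sum tensor_rels.balanced) (use y g \<psi> in auto)
    ultimately have "frag_of (d, \<Sum>i<n. la (\<psi> i y) (g i)) - (\<Sum>i<n. frag_of (d, la (\<psi> i y) (g i)))
      - (\<Sum>i<n. frag_of (d * \<psi> i y, g i) - frag_of (d, la (\<psi> i y) (g i))) \<in> ?K"
      by (rule tensor_rels.diff)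
    then show ?case
      by (simp add: p x[OF y] sum_subtractf)
  next
    case (diff v w)
    let ?e = "\<lambda>i. frag_eval (\<lambda>d x. d * \<psi> i x)"
    have "(\<Sum>i<n. frag_of (?e i (v - w) + ?e i w, g i) - frag_of (?e i (v - w), g i)
        - frag_of (?e i w, g i)) \<in> ?K"
      by (intro tensor_rels_sum add) auto
    from tensor_rels_add[OF tensor_rels.diff[OF diff] this] show ?case
      by (simp add: frag_eval_diff sum_subtractf sum.distrib algebra_simps)
  qed
qed

section \<open>Comodule dg algebras\<close>

context comodule_dg_algebra
begin

sublocale graded: graded_space UNIV "dga_grade D"
  by unfold_locales (rule grading)

lemma degree_zero_subring: "subring (dga_grade D 0)"
  using grade_mult[of _ 0 _ 0] grade_one graded.grade_zero
    complex_vector.subspace_diff[OF graded.grade_sub[of 0]]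
  by (auto simp: subring_def)

lemma hcomp_mult_left:
  assumes "a \<in> dga_grade D i"
  shows "hcomp (dga_grade D) (i + k) (a * b) = a * hcomp (dga_grade D) k b"
  using UNIV_I[of b]
proof (induction b rule: graded.graded_induct)
  case (homogeneous j y)
  then show ?case
    using grade_mult[OF assms]
    by (simp add: graded.hcomp_homogeneous[of _ j] graded.hcomp_homogeneous[of _ "i + j"])
next
  case (add y z)
  then show ?case by (simp add: distrib_left graded.hcomp_add)
qed

lemma degree_zero_comodule_algebra: "comodule_algebra A (degree_zero_alg D)"
proof -
  note comodule = coact_linear coact_coassoc coact_counit coact_one coact_mult
  note inherited = comodule[unfolded underlying_alg_def comod_alg.simps]
    graded.grade_sub coact_grade grade_one grade_mult[of _ 0 _ 0, simplified]
  interpret coaction: Vector_Spaces.linear scaleC scaleC "dga_coact D"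
    by (rule inherited)
  show ?thesis
    by (unfold_locales; unfold degree_zero_alg_def comod_alg.simps;
        rule coaction.add coaction.scale inherited; (rule UNIV_I | assumption))
qed

end

section \<open>The multiplication map\<close>

context comodule_dg_bimodule
begin

sublocale XG: graded_space UNIV "grade X"
  by (unfold_locales) (rule grading)

lemma D_module: "left_module UNIV UNIV (lact X)"
  using left.left_module_axioms by (simp add: underlying_alg_def underlying_bimod_def)

lemma E_module: "right_module UNIV UNIV (ract X)"
  using right.right_module_axioms by (simp add: underlying_alg_def underlying_bimod_def)

lemma lact_add_left: "lact X (a + b) x = lact X a x + lact X b x"
  and lact_add_right: "lact X a (x + y) = lact X a x + lact X a y"
  and lact_lact: "lact X a (lact X b x) = lact X (a * b) x"
  and lact_1: "lact X 1 x = x"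
  using D_module by (simp_all add: left_module_def)

lemma lact_diff_right: "lact X a (x - y) = lact X a x - lact X a y"
  using lact_add_right[of a "x - y" y] by (simp add: algebra_simps)

lemma ract_diff_left: "ract X (x - y) b = ract X x b - ract X y b"
  using right_module.act_add_left[OF E_module, of b "x - y" y] by (simp add: algebra_simps)

lemma ract_lact_commute: "ract X (lact X a x) b = lact X a (ract X x b)"
  using lact_ract by (simp add: underlying_alg_def underlying_bimod_def)

lemma degree_zero_module: "left_module (dga_grade D 0) (grade X 0) (lact X)"
proof
  fix r x assume "r \<in> dga_grade D 0" "x \<in> grade X 0"
  then show "lact X r x \<in> grade X 0"
    using grade_lact[of r 0 x 0] by simp
qed (auto simp: XG.grade_zero lact_add_left lact_add_right lact_lact lact_1
    intro: complex_vector.subspace_diff[OF XG.grade_sub])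

lemma mult_map_class:
  "mult_map X (tensor_class (dga_grade D 0) UNIV (grade X 0) (*) (lact X) u) = frag_eval (lact X) u"
  unfolding mult_map_def
  by (rule coset_eval_class) (simp_all add: lact_add_left lact_add_right lact_lact)

lemma tens0_carrier_iff:
  "S \<in> tens0_carrier D X \<longleftrightarrow> (\<exists>u. Poly_Mapping.keys u \<subseteq> UNIV \<times> grade X 0 \<and>
    S = tensor_class (dga_grade D 0) UNIV (grade X 0) (*) (lact X) u)"
  unfolding tens0_carrier_def tensor_carrier_def by blast

text \<open>Evaluates also sets like \<open>coset_add S T\<close> and \<open>coset_map K h S\<close> directly from their elements,
  without first recognizing them as cosets.\<close>

lemma coset_eval_eqI:
  assumes "S \<noteq> {}" "\<And>u. u \<in> S \<Longrightarrow> frag_eval f u = x"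
  shows "coset_eval f S = x"
proof -
  have "frag_eval f ` S = {x}" using assms by auto
  then show ?thesis by (simp add: coset_eval_def)
qed

lemma rels_eval:
  "v - u \<in> tens0_rels D X \<Longrightarrow> frag_eval (lact X) v = frag_eval (lact X) u"
  using frag_eval_tensor_rels[of "v - u" "dga_grade D 0" UNIV "grade X 0" "(*)" "lact X" "lact X"]
  by (simp add: tens0_rels_def frag_eval_diff lact_add_left lact_add_right lact_lact)

lemma mult_map_rep:
  assumes "S \<in> tens0_carrier D X" "u \<in> S"
  shows "mult_map X S = frag_eval (lact X) u"
proof -
  obtain w where S: "S = tensor_class (dga_grade D 0) UNIV (grade X 0) (*) (lact X) w"
    using assms(1) tens0_carrier_iff by blast
  show ?thesis
    unfolding S mult_map_class
    by (rule rels_eval[symmetric]) (use assms(2) S in \<open>simp add: tensor_class_def tens0_rels_def\<close>)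
qed

lemma tens0_carrier_nonempty:
  assumes "S \<in> tens0_carrier D X" shows "\<exists>u. u \<in> S"
proof -
  obtain u where "S = tensor_class (dga_grade D 0) UNIV (grade X 0) (*) (lact X) u"
    using assms tens0_carrier_iff by blast
  then have "u \<in> S"
    by (simp add: tensor_class_def tensor_rels.zero)
  then show ?thesis ..
qed

lemma mult_map_add:
  assumes "S \<in> tens0_carrier D X" "T \<in> tens0_carrier D X"
  shows "mult_map X (coset_add S T) = mult_map X S + mult_map X T"
  unfolding mult_map_def
proof (rule coset_eval_eqI)
  show "coset_add S T \<noteq> {}"
    using assms[THEN tens0_carrier_nonempty] by (auto simp: coset_add_def)
  show "frag_eval (lact X) u = coset_eval (lact X) S + coset_eval (lact X) T"
    if "u \<in> coset_add S T" for u
    using that assms[THEN mult_map_rep] by (auto simp: coset_add_def frag_eval_add mult_map_def)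
qed

text \<open>This covers both module structures of the tensor product, because left and right
  multiplications are given by maps of generators.\<close>

lemma mult_map_coset_map:
  assumes "S \<in> tens0_carrier D X" "\<And>x y. L (x - y) = L x - L y"
    and "\<And>d x. lact X (fst (h (d, x))) (snd (h (d, x))) = L (lact X d x)"
  shows "mult_map X (coset_map (tens0_rels D X) h S) = L (mult_map X S)"
  unfolding mult_map_def
proof (rule coset_eval_eqI)
  obtain u where "u \<in> S"
    using tens0_carrier_nonempty[OF assms(1)] by blast
  moreover have "frag_map h u - frag_map h u \<in> tens0_rels D X"
    by (simp add: tens0_rels_def tensor_rels.zero)
  ultimately show "coset_map (tens0_rels D X) h S \<noteq> {}"
    unfolding coset_map_def by blast
next
  fix v assume "v \<in> coset_map (tens0_rels D X) h S"
  then obtain u where u: "u \<in> S" "v - frag_map h u \<in> tens0_rels D X"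
    by (auto simp: coset_map_def)
  have "frag_eval (lact X) v = L (frag_eval (lact X) u)"
    using rels_eval[OF u(2)] frag_eval_frag_map[OF subset_UNIV, of L "lact X" h "lact X" u] assms
    by simp
  then show "frag_eval (lact X) v = L (coset_eval (lact X) S)"
    using mult_map_rep[OF assms(1) u(1)] by (simp add: mult_map_def)
qed

text \<open>The multiplication map is always a homomorphism of bimodules, so bijectivity is the
  whole content of being an isomorphism.\<close>

lemma mult_map_iso_iff_bij:
  "mult_map_iso D E X \<longleftrightarrow> bij_betw (mult_map X) (tens0_carrier D X) UNIV"
proof -
  have "mult_map X (tens0_lact D X a S) = lact X a (mult_map X S)"
    if "S \<in> tens0_carrier D X" for a S
    unfolding tens0_lact_def using that
    by (rule mult_map_coset_map) (simp_all add: lact_diff_right lact_lact)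
  moreover have "mult_map X (tens0_ract D X S e) = ract X (mult_map X S) e"
    if "S \<in> tens0_carrier D X" for e S
    unfolding tens0_ract_def using that
    by (rule mult_map_coset_map) (simp_all add: ract_diff_left ract_lact_commute)
  ultimately show ?thesis
    unfolding mult_map_iso_def using mult_map_add by blast
qed

text \<open>Choosing representatives once and for all frees the later arguments from cosets: surjectivity
  and triviality of the kernel become conditions on formal sums of pairs.\<close>

lemma mult_map_bij_iff:
  "bij_betw (mult_map X) (tens0_carrier D X) UNIV \<longleftrightarrow>
    (\<forall>x. \<exists>u. Poly_Mapping.keys u \<subseteq> UNIV \<times> grade X 0 \<and> frag_eval (lact X) u = x) \<and>
    (\<forall>u. Poly_Mapping.keys u \<subseteq> UNIV \<times> grade X 0 \<longrightarrow> frag_eval (lact X) u = 0 \<longrightarrow>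
      u \<in> tens0_rels D X)" (is "?bij \<longleftrightarrow> ?surj \<and> ?inj")
proof -
  let ?c = "tensor_class (dga_grade D 0) UNIV (grade X 0) (*) (lact X)"
  have class_eq: "?c u = ?c v \<longleftrightarrow> u - v \<in> tens0_rels D X" for u v
  proof
    assume "?c u = ?c v"
    then have "u \<in> ?c v"
      by (metis (no_types, lifting) diff_self mem_Collect_eq tensor_class_def tensor_rels.zero)
    then show "u - v \<in> tens0_rels D X"
      by (simp add: tensor_class_def tens0_rels_def)
  next
    assume uv: "u - v \<in> tens0_rels D X"
    have "w - u \<in> tens0_rels D X \<longleftrightarrow> w - v \<in> tens0_rels D X" for w
      using uv tensor_rels_add[of "w - u" _ _ _ _ _ "u - v"] tensor_rels.diff[of "w - v" _ _ _ _ _ "u - v"]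
      by (auto simp: tens0_rels_def)
    then show "?c u = ?c v"
      by (simp add: tensor_class_def tens0_rels_def)
  qed
  have surj: "mult_map X ` tens0_carrier D X = UNIV \<longleftrightarrow> ?surj"
  proof -
    have "mult_map X ` tens0_carrier D X =
        frag_eval (lact X) ` {u. Poly_Mapping.keys u \<subseteq> UNIV \<times> grade X 0}"
      by (auto simp: tens0_carrier_def tensor_carrier_def image_image mult_map_class)
    then show ?thesis
      by (auto simp: image_iff set_eq_iff) metis+
  qed
  have "inj_on (mult_map X) (tens0_carrier D X) \<longleftrightarrow> ?inj"
  proof
    assume inj: "inj_on (mult_map X) (tens0_carrier D X)"
    show ?inj
    proof (intro allI impI)
      fix u :: "'d \<times> 'x \<Rightarrow>\<^sub>0 int"
      assume u: "Poly_Mapping.keys u \<subseteq> UNIV \<times> grade X 0" "frag_eval (lact X) u = 0"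
      have "?c u \<in> tens0_carrier D X" "?c 0 \<in> tens0_carrier D X"
        using u(1) unfolding tens0_carrier_iff by (blast, force)
      moreover have "mult_map X (?c u) = mult_map X (?c 0)"
        by (simp add: mult_map_class u(2))
      ultimately have "?c u = ?c 0"
        using inj by (simp add: inj_on_def)
      then show "u \<in> tens0_rels D X"
        by (simp add: class_eq)
    qed
  next
    assume inj: ?inj
    show "inj_on (mult_map X) (tens0_carrier D X)"
    proof (rule inj_onI)
      fix S T assume "S \<in> tens0_carrier D X" "T \<in> tens0_carrier D X"
        and eq: "mult_map X S = mult_map X T"
      then obtain u v where u: "Poly_Mapping.keys u \<subseteq> UNIV \<times> grade X 0" "S = ?c u"
        and v: "Poly_Mapping.keys v \<subseteq> UNIV \<times> grade X 0" "T = ?c v"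
        by (auto simp: tens0_carrier_iff)
      have "Poly_Mapping.keys (u - v) \<subseteq> UNIV \<times> grade X 0"
        using keys_diff[of u v] u(1) v(1) by blast
      moreover have "frag_eval (lact X) (u - v) = 0"
        using eq by (simp add: u v mult_map_class frag_eval_diff)
      ultimately have "u - v \<in> tens0_rels D X"
        using inj by blast
      then show "S = T"
        by (simp add: u v class_eq)
    qed
  qed
  with surj show ?thesis
    by (auto simp: bij_betw_def)
qed

section \<open>Graded dual bases\<close>

definition graded_dual_basis :: "nat \<Rightarrow> (nat \<Rightarrow> 'x) \<Rightarrow> (nat \<Rightarrow> 'x \<Rightarrow> 'd) \<Rightarrow> bool"
  where "graded_dual_basis n g \<phi> \<longleftrightarrow> dual_basis UNIV UNIV (lact X) n g \<phi> \<and>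
    (\<forall>i<n. g i \<in> grade X 0 \<and> (\<forall>k. \<phi> i ` grade X k \<subseteq> dga_grade D k))"

lemma UNIV_subring: "subring UNIV"
  by (simp add: subring_def)

text \<open>Multiplication by an element of degree zero does not shift degrees.  This is where the
  generators are required to have degree zero.\<close>

lemma hcomp_lact_right:
  assumes "x \<in> grade X 0"
  shows "hcomp (grade X) k (lact X a x) = lact X (hcomp (dga_grade D) k a) x"
  using UNIV_I[of a]
proof (induction a rule: D.graded.graded_induct)
  case (homogeneous j b)
  then show ?case
    using grade_lact[of b j x 0] assms left_module_zero_act[OF D_module UNIV_I UNIV_I]
    by (simp add: XG.hcomp_homogeneous[of _ j] D.graded.hcomp_homogeneous[of _ j])
next
  case (add y z)
  then show ?case by (simp add: lact_add_left XG.hcomp_add D.graded.hcomp_add)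
qed

lemma hcomp_X_sum:
  "finite S \<Longrightarrow> hcomp (grade X) k (sum f S) = (\<Sum>i\<in>S. hcomp (grade X) k (f i))"
  by (induction S rule: finite_induct) (simp_all add: XG.hcomp_0 XG.hcomp_add)

text \<open>The degree zero part of an additive map between graded spaces: of the image of a homogeneous
  element only the component of the same degree is kept.\<close>

definition degree_zero_part :: "('x \<Rightarrow> 'd) \<Rightarrow> 'x \<Rightarrow> 'd"
  where "degree_zero_part h x =
    (\<Sum>k | hcomp (grade X) k x \<noteq> 0. hcomp (dga_grade D) k (h (hcomp (grade X) k x)))"

lemma degree_zero_part_homogeneous:
  assumes "h 0 = 0" "x \<in> grade X k"
  shows "degree_zero_part h x = hcomp (dga_grade D) k (h x)"
proof -
  have "degree_zero_part h x =
      (\<Sum>j\<in>{k}. hcomp (dga_grade D) j (h (hcomp (grade X) j x)))"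
    unfolding degree_zero_part_def
    by (rule sum.mono_neutral_left)
      (auto simp: XG.hcomp_homogeneous[OF assms(2)] assms(1) D.graded.hcomp_0)
  then show ?thesis
    by (simp add: XG.hcomp_homogeneous[OF assms(2)])
qed

lemma degree_zero_part_superset:
  assumes "h 0 = 0" "finite S" "{k. hcomp (grade X) k x \<noteq> 0} \<subseteq> S"
  shows "degree_zero_part h x =
    (\<Sum>k\<in>S. hcomp (dga_grade D) k (h (hcomp (grade X) k x)))"
  unfolding degree_zero_part_def
  by (rule sum.mono_neutral_left) (use assms in \<open>auto simp: D.graded.hcomp_0\<close>)

lemma degree_zero_part_add:
  assumes h: "\<And>x y. h (x + y) = h x + h y"
  shows "degree_zero_part h (x + y) = degree_zero_part h x + degree_zero_part h y"
proof -
  let ?S = "{k. hcomp (grade X) k x \<noteq> 0} \<union> {k. hcomp (grade X) k y \<noteq> 0}"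
  have h0: "h 0 = 0" using h[of 0 0] by simp
  have fin: "finite ?S" by (simp add: XG.hcomp_props(1))
  have "{k. hcomp (grade X) k (x + y) \<noteq> 0} \<subseteq> ?S" by (auto simp: XG.hcomp_add)
  from degree_zero_part_superset[of h, OF h0 fin this]
    degree_zero_part_superset[of h ?S x, OF h0 fin] degree_zero_part_superset[of h ?S y, OF h0 fin]
  show ?thesis
    by (simp add: XG.hcomp_add D.graded.hcomp_add h sum.distrib)
qed

lemma degree_zero_part_lact:
  assumes h: "\<And>x y. h (x + y) = h x + h y" and hl: "\<And>a x. h (lact X a x) = a * h x"
  shows "degree_zero_part h (lact X a x) = a * degree_zero_part h x"
proof -
  have h0: "h 0 = 0" using h[of 0 0] by simp
  have "\<forall>x. degree_zero_part h (lact X a x) = a * degree_zero_part h x"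
    using UNIV_I[of a]
  proof (induction a rule: D.graded.graded_induct)
    case (homogeneous i a)
    show ?case
    proof
      fix x show "degree_zero_part h (lact X a x) = a * degree_zero_part h x"
        using UNIV_I[of x]
      proof (induction x rule: XG.graded_induct)
        case (homogeneous j x)
        then show ?case
          using grade_lact[OF \<open>a \<in> dga_grade D i\<close>, of x j] D.hcomp_mult_left[OF \<open>a \<in> dga_grade D i\<close>]
          by (simp add: degree_zero_part_homogeneous[of h, OF h0] hl)
      next
        case (add x y)
        then show ?case
          by (simp add: lact_add_right degree_zero_part_add[of h, OF h] distrib_left)
      qed
    qed
  next
    case (add a b)
    then show ?case
      by (simp add: lact_add_left degree_zero_part_add[of h, OF h] distrib_right)
  qed
  then show ?thesis by blast
qed

text \<open>For homogeneous \<open>x\<close> of degree \<open>k\<close>, take the degree \<open>k\<close> component of \<open>x = \<Sum>i. \<phi> i x * g i\<close>: since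
  \<open>g i\<close> has degree zero, it is the sum of the degree \<open>k\<close> components of \<open>\<phi> i x\<close> times \<open>g i\<close>.\<close>

lemma dual_basis_imp_graded:
  assumes db: "dual_basis UNIV UNIV (lact X) n g \<phi>" and g: "\<And>i. i < n \<Longrightarrow> g i \<in> grade X 0"
  shows "graded_dual_basis n g (\<lambda>i. degree_zero_part (\<phi> i))"
proof -
  have \<phi>_add: "\<phi> i (x + y) = \<phi> i x + \<phi> i y" and lin: "\<phi> i (lact X a x) = a * \<phi> i x"
    if "i < n" for i a x y
    using db that by (auto simp: dual_basis_def left_module_hom_def)
  have zero: "\<phi> i 0 = 0" if "i < n" for i using \<phi>_add[OF that, of 0 0] by simp
  have "(\<Sum>i<n. lact X (degree_zero_part (\<phi> i) x) (g i)) = x" for x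
    using UNIV_I[of x]
  proof (induction x rule: XG.graded_induct)
    case (homogeneous k x)
    have "(\<Sum>i<n. lact X (degree_zero_part (\<phi> i) x) (g i)) =
        (\<Sum>i<n. hcomp (grade X) k (lact X (\<phi> i x) (g i)))"
      by (rule sum.cong)
        (use homogeneous zero g in \<open>auto simp: degree_zero_part_homogeneous hcomp_lact_right\<close>)
    also have "\<dots> = hcomp (grade X) k x"
      using db by (simp add: hcomp_X_sum[symmetric] dual_basis_def)
    finally show ?case
      using XG.hcomp_homogeneous[OF homogeneous] by simp
  next
    case (add x y)
    have "(\<Sum>i<n. lact X (degree_zero_part (\<phi> i) (x + y)) (g i)) =
        (\<Sum>i<n. lact X (degree_zero_part (\<phi> i) x) (g i) + lact X (degree_zero_part (\<phi> i) y) (g i))"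
      by (rule sum.cong) (auto simp: degree_zero_part_add \<phi>_add lact_add_left)
    then show ?case
      using add.IH by (simp add: sum.distrib)
  qed
  moreover have "left_module_hom UNIV UNIV (lact X) UNIV (*) (degree_zero_part (\<phi> i))"
    if "i < n" for i
    using degree_zero_part_add[of "\<phi> i"] degree_zero_part_lact[of "\<phi> i"] \<phi>_add[OF that] lin[OF that]
    by (simp add: left_module_hom_def)
  moreover have "degree_zero_part (\<phi> i) x \<in> dga_grade D k" if "i < n" "x \<in> grade X k" for i k x
    using degree_zero_part_homogeneous[of "\<phi> i", OF zero[OF that(1)] that(2)] D.graded.hcomp_props(2)[OF UNIV_I]
    by simp
  ultimately show ?thesis
    using g by (auto simp: graded_dual_basis_def dual_basis_def)
qed

lemma dg0_lproj_iff_graded_dual_basis: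
  "X \<in> dg0_lproj A D E \<longleftrightarrow> (\<exists>n g \<phi>. graded_dual_basis n g \<phi>)"
proof
  assume "X \<in> dg0_lproj A D E"
  then obtain G where P: "projective UNIV UNIV (lact X)" and G: "finite G" "G \<subseteq> grade X 0"
    "left_span UNIV (lact X) G = UNIV"
    by (auto simp: dg0_lproj_def)
  obtain n g \<phi> where "g ` {..<n} = G" "dual_basis UNIV UNIV (lact X) n g \<phi>"
    using projective_imp_dual_basis[OF UNIV_subring P G(1) subset_UNIV G(3)] by blast
  with G(2) have "graded_dual_basis n g (\<lambda>i. degree_zero_part (\<phi> i))"
    by (intro dual_basis_imp_graded) auto
  then show "\<exists>n g \<phi>. graded_dual_basis n g \<phi>"
    by blast
next
  assume "\<exists>n g \<phi>. graded_dual_basis n g \<phi>"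
  then obtain n g \<phi> where db: "dual_basis UNIV UNIV (lact X) n g \<phi>"
    and g: "g ` {..<n} \<subseteq> grade X 0"
    by (auto simp: graded_dual_basis_def)
  have "X \<in> dg_Mod A D E"
    by (simp add: dg_Mod_def comodule_dg_bimodule_axioms)
  moreover have "\<exists>G. finite G \<and> G \<subseteq> grade X 0 \<and> left_span UNIV (lact X) G = UNIV"
    using dual_basis_imp_span[OF UNIV_subring D_module db] g by blast
  ultimately show "X \<in> dg0_lproj A D E"
    using dual_basis_imp_projective[OF UNIV_subring D_module db] by (simp add: dg0_lproj_def)
qed

section \<open>The degree zero component\<close>

text \<open>All structure restricts to degree zero because the actions add degrees and the coaction
  preserves them.\<close>

lemma degree_zero_comodule_bimodule:
  "comodule_bimodule A (degree_zero_alg D) (degree_zero_alg E) (degree_zero X)"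
proof -
  interpret D0: comodule_algebra A "degree_zero_alg D"
    by (rule D.degree_zero_comodule_algebra)
  interpret E0: comodule_algebra A "degree_zero_alg E"
    by (rule E.degree_zero_comodule_algebra)
  interpret X0: left_module "alg_carrier (degree_zero_alg D)" "bim_carrier (degree_zero X)"
    "bim_lact (degree_zero X)"
    using degree_zero_module by (simp add: degree_zero_alg_def degree_zero_def)
  interpret X0r: right_module "alg_carrier (degree_zero_alg E)" "bim_carrier (degree_zero X)"
    "bim_ract (degree_zero X)"
  proof
    fix r x assume "r \<in> alg_carrier (degree_zero_alg E)" "x \<in> bim_carrier (degree_zero X)"
    then show "bim_ract (degree_zero X) x r \<in> bim_carrier (degree_zero X)"
      using grade_ract[of x 0 r 0] by (simp add: degree_zero_alg_def degree_zero_def)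
  qed (use E_module X0.zero_mem X0.diff_mem in
      \<open>auto simp: degree_zero_alg_def degree_zero_def right_module_def\<close>)
  note bimodule = coact_linear coact_coassoc coact_counit lact_bilinear ract_bilinear lact_ract
    coact_lact coact_ract
  note inherited = bimodule[unfolded underlying_alg_def underlying_bimod_def comod_alg.simps
      comod_bimod.simps]
    coact_grade XG.grade_sub
  interpret coaction: Vector_Spaces.linear scaleC scaleC "coact X"
    by (rule inherited)
  show ?thesis
    by (unfold_locales; unfold degree_zero_def degree_zero_alg_def comod_alg.simps comod_bimod.simps;
        rule coaction.add coaction.scale inherited; (rule UNIV_I | assumption))
qed

lemma degree_zero_lproj_iff:
  "degree_zero X \<in> lproj A (degree_zero_alg D) (degree_zero_alg E) \<longleftrightarrow>
    (\<exists>n g \<psi>. dual_basis (dga_grade D 0) (grade X 0) (lact X) n g \<psi>)"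
proof -
  let ?D = "dga_grade D 0" and ?X = "grade X 0"
  have "degree_zero X \<in> lproj A (degree_zero_alg D) (degree_zero_alg E) \<longleftrightarrow>
      projective ?D ?X (lact X) \<and> (\<exists>G. finite G \<and> G \<subseteq> ?X \<and> left_span ?D (lact X) G = ?X)"
    using degree_zero_comodule_bimodule
    by (simp add: lproj_def degree_zero_def degree_zero_alg_def)
  also have "\<dots> \<longleftrightarrow> (\<exists>n g \<psi>. dual_basis ?D ?X (lact X) n g \<psi>)"
  proof
    assume "projective ?D ?X (lact X) \<and> (\<exists>G. finite G \<and> G \<subseteq> ?X \<and> left_span ?D (lact X) G = ?X)"
    then obtain G where P: "projective ?D ?X (lact X)"
      and G: "finite G" "G \<subseteq> ?X" "left_span ?D (lact X) G = ?X"
      by auto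
    show "\<exists>n g \<psi>. dual_basis ?D ?X (lact X) n g \<psi>"
      using projective_imp_dual_basis[OF D.degree_zero_subring P G] by auto
  next
    assume "\<exists>n g \<psi>. dual_basis ?D ?X (lact X) n g \<psi>"
    then obtain n g \<psi> where db: "dual_basis ?D ?X (lact X) n g \<psi>" by blast
    then have "g ` {..<n} \<subseteq> ?X" by (auto simp: dual_basis_def)
    then show "projective ?D ?X (lact X) \<and> (\<exists>G. finite G \<and> G \<subseteq> ?X \<and> left_span ?D (lact X) G = ?X)"
      using dual_basis_imp_projective[OF D.degree_zero_subring degree_zero_module db]
        dual_basis_imp_span[OF D.degree_zero_subring degree_zero_module db]
      by (intro conjI exI[of _ "g ` {..<n}"]) auto
  qed
  finally show ?thesis .
qed

lemma graded_dual_basis_imp_degree_zero: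
  assumes "graded_dual_basis n g \<phi>"
  shows "dual_basis (dga_grade D 0) (grade X 0) (lact X) n g \<phi>"
  using assms by (auto simp: graded_dual_basis_def dual_basis_def left_module_hom_def)

text \<open>The inverse of \<open>\<mu>\<close> is \<open>x \<mapsto> \<Sum>i. \<phi> i x \<otimes> g i\<close>: dual basis expansion shows that every tensor \<open>t\<close>
  equals \<open>\<Sum>i. \<phi> i (\<mu> t) \<otimes> g i\<close>, which vanishes when \<open>\<mu> t\<close> does.\<close>

lemma graded_dual_basis_imp_mult_map_bij:
  assumes gdb: "graded_dual_basis n g \<phi>"
  shows "bij_betw (mult_map X) (tens0_carrier D X) UNIV"
  unfolding mult_map_bij_iff
proof (intro conjI allI impI)
  have g: "\<And>i. i < n \<Longrightarrow> g i \<in> grade X 0"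
    and add: "\<And>i x y. i < n \<Longrightarrow> \<phi> i (x + y) = \<phi> i x + \<phi> i y"
    and lin: "\<And>i a x. i < n \<Longrightarrow> \<phi> i (lact X a x) = a * \<phi> i x"
    and x: "\<And>x. (\<Sum>i<n. lact X (\<phi> i x) (g i)) = x"
    using gdb by (auto simp: graded_dual_basis_def dual_basis_def left_module_hom_def)
  have diff: "\<phi> i (x - y) = \<phi> i x - \<phi> i y" if "i < n" for i x y
    using add[OF that, of "x - y" y] by (simp add: algebra_simps)
  {
    fix x
    let ?u = "\<Sum>i<n. frag_of (\<phi> i x, g i)"
    have "Poly_Mapping.keys ?u \<subseteq> (\<Union>i<n. Poly_Mapping.keys (frag_of (\<phi> i x, g i)))"
      by (rule Poly_Mapping.keys_sum)
    then have "Poly_Mapping.keys ?u \<subseteq> UNIV \<times> grade X 0"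
      using g by auto
    moreover have "frag_eval (lact X) ?u = x"
    proof -
      have "frag_eval (lact X) (\<Sum>i\<in>S. frag_of (\<phi> i x, g i)) = (\<Sum>i\<in>S. lact X (\<phi> i x) (g i))"
        if "finite S" for S
        using that by induction (simp_all add: frag_eval_add)
      then show ?thesis using x by simp
    qed
    ultimately show "\<exists>u. Poly_Mapping.keys u \<subseteq> UNIV \<times> grade X 0 \<and> frag_eval (lact X) u = x"
      by blast
  }
  fix u :: "'d \<times> 'x \<Rightarrow>\<^sub>0 int"
  assume u: "Poly_Mapping.keys u \<subseteq> UNIV \<times> grade X 0" "frag_eval (lact X) u = 0"
  have eval: "frag_eval (\<lambda>d x. d * \<phi> i x) u = 0" if "i < n" for i
    using frag_eval_frag_map[OF subset_UNIV, of "\<phi> i" "\<lambda>d x. d * \<phi> i x" "\<lambda>p. p" "lact X" u]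
      frag_expansion[of u, symmetric] diff[OF that] lin[OF that] diff[OF that, of 0 0] u(2) by simp
  have "u - (\<Sum>i<n. frag_of (frag_eval (\<lambda>d x. d * \<phi> i x) u, g i)) \<in> tens0_rels D X"
    using tensor_dual_basis_expansion[OF degree_zero_module
        graded_dual_basis_imp_degree_zero[OF gdb] u(1)] by (simp add: tens0_rels_def)
  moreover have "(\<Sum>i<n. frag_of (frag_eval (\<lambda>d x. d * \<phi> i x) u, g i)) \<in> tens0_rels D X"
    unfolding tens0_rels_def
  proof (intro tensor_rels_sum)
    fix i assume "i \<in> {..<n}"
    then have "frag_of (0 + 0, g i) - frag_of (0, g i) - frag_of (0, g i)
        \<in> tensor_rels (dga_grade D 0) UNIV (grade X 0) (*) (lact X)"
      using g by (intro tensor_rels.add_left) auto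
    from tensor_rels_uminus[OF this] show "frag_of (frag_eval (\<lambda>d x. d * \<phi> i x) u, g i)
        \<in> tensor_rels (dga_grade D 0) UNIV (grade X 0) (*) (lact X)"
      using eval \<open>i \<in> {..<n}\<close> by simp
  qed simp
  ultimately show "u \<in> tens0_rels D X"
    unfolding tens0_rels_def using tensor_rels_add by fastforce
qed

text \<open>The functional \<open>\<psi> i\<close> on \<open>\<XX>\<^sup>0\<close> induces \<open>d \<otimes> y \<mapsto> d * \<psi> i y\<close> on the tensor product, and \<open>\<phi> i\<close> is its
  composition with the inverse of \<open>\<mu>\<close>.\<close>

lemma mult_map_bij_imp_graded_dual_basis:
  assumes bij: "bij_betw (mult_map X) (tens0_carrier D X) UNIV"
    and db: "dual_basis (dga_grade D 0) (grade X 0) (lact X) n g \<psi>"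
  shows "\<exists>\<phi>. graded_dual_basis n g \<phi>"
proof -
  let ?K = "\<lambda>u. Poly_Mapping.keys u \<subseteq> UNIV \<times> grade X 0"
  let ?e = "frag_eval (lact X)"
  have g: "\<And>i. i < n \<Longrightarrow> g i \<in> grade X 0"
    and \<psi>D: "\<And>i x. i < n \<Longrightarrow> x \<in> grade X 0 \<Longrightarrow> \<psi> i x \<in> dga_grade D 0"
    and add: "\<And>i x y. i < n \<Longrightarrow> x \<in> grade X 0 \<Longrightarrow> y \<in> grade X 0 \<Longrightarrow> \<psi> i (x + y) = \<psi> i x + \<psi> i y"
    and lin: "\<And>i a x. i < n \<Longrightarrow> a \<in> dga_grade D 0 \<Longrightarrow> x \<in> grade X 0 \<Longrightarrow> \<psi> i (lact X a x) = a * \<psi> i x"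
    and sum: "\<And>x. x \<in> grade X 0 \<Longrightarrow> (\<Sum>i<n. lact X (\<psi> i x) (g i)) = x"
    using db by (auto simp: dual_basis_def left_module_hom_def image_subset_iff)
  let ?\<psi> = "\<lambda>i. frag_eval (\<lambda>d x. d * \<psi> i x)"
  have "\<forall>x. \<exists>u. ?K u \<and> ?e u = x"
    using bij mult_map_bij_iff by blast
  then obtain U where U: "\<And>x. ?K (U x)" "\<And>x. ?e (U x) = x"
    by metis
  define \<phi> where "\<phi> = (\<lambda>i x. ?\<psi> i (U x))"
  \<comment> \<open>By injectivity of \<open>\<mu>\<close> the representative \<open>U x\<close> may be replaced by any other one.  Choosing it well
    makes each property of \<open>\<phi> i\<close> a property of generators.\<close>
  have \<phi>: "\<phi> i x = ?\<psi> i u" if "i < n" "?K u" "?e u = x" for i u x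
  proof -
    have "?K (U x - u)"
      using keys_diff[of "U x" u] U(1)[of x] that(2) by blast
    moreover have "?e (U x - u) = 0"
      by (simp add: frag_eval_diff U that(3))
    ultimately have "U x - u \<in> tens0_rels D X"
      using bij mult_map_bij_iff by blast
    then have "?\<psi> i (U x - u) = 0"
      unfolding tens0_rels_def
      by (rule frag_eval_tensor_rels)
        (simp_all add: add[OF that(1)] lin[OF that(1)] algebra_simps)
    then show ?thesis
      by (simp add: \<phi>_def frag_eval_diff)
  qed
  have \<phi>_add: "\<phi> i (x + y) = \<phi> i x + \<phi> i y" if "i < n" for i x y
  proof -
    have "\<phi> i (x + y) = ?\<psi> i (U x + U y)"
    proof (rule \<phi>[OF that])
      show "?K (U x + U y)"
        using Poly_Mapping.keys_add[of "U x" "U y"] U(1) by blast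
    qed (simp add: frag_eval_add U)
    then show ?thesis
      by (simp add: frag_eval_add \<phi>_def)
  qed
  have \<phi>_lin: "\<phi> i (lact X a x) = a * \<phi> i x" if "i < n" for i a x
  proof -
    let ?h = "\<lambda>p :: 'd \<times> 'x. (a * fst p, snd p)"
    have "\<phi> i (lact X a x) = ?\<psi> i (frag_map ?h (U x))"
    proof (rule \<phi>[OF that])
      show "?K (frag_map ?h (U x))"
        using keys_frag_map[of ?h "U x"] U(1)[of x] by fastforce
      show "?e (frag_map ?h (U x)) = lact X a x"
        using frag_eval_frag_map[OF U(1), of "lact X a" "lact X" ?h "lact X" x]
        by (simp add: lact_diff_right lact_lact U(2))
    qed
    also have "\<dots> = a * ?\<psi> i (U x)"
      by (rule frag_eval_frag_map[OF U(1)]) (simp_all add: algebra_simps)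
    finally show ?thesis
      by (simp add: \<phi>_def)
  qed
  have \<phi>_grade: "\<phi> i x \<in> dga_grade D k" if "i < n" "x \<in> grade X k" for i k x
  proof -
    \<comment> \<open>If \<open>x = \<Sum> d y\<close> has degree \<open>k\<close> then also \<open>x = \<Sum> d\<^sub>k y\<close>, because each \<open>y\<close> has degree zero.\<close>
    let ?h = "\<lambda>p :: 'd \<times> 'x. (hcomp (dga_grade D) k (fst p), snd p)"
    have hdiff: "hcomp (dga_grade D) k (c - d) = hcomp (dga_grade D) k c - hcomp (dga_grade D) k d"
      for c d
      using D.graded.hcomp_add[of "c - d" d k] by (simp add: algebra_simps)
    have hdiffX: "hcomp (grade X) k (c - d) = hcomp (grade X) k c - hcomp (grade X) k d" for c d
      using XG.hcomp_add[of "c - d" d k] by (simp add: algebra_simps)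
    have "\<phi> i x = ?\<psi> i (frag_map ?h (U x))"
    proof (rule \<phi>[OF that(1)])
      show "?K (frag_map ?h (U x))"
        using keys_frag_map[of ?h "U x"] U(1)[of x] by fastforce
      have "?e (frag_map ?h (U x)) = hcomp (grade X) k (?e (U x))"
        by (rule frag_eval_frag_map[OF U(1)]) (auto simp: hdiffX hcomp_lact_right)
      then show "?e (frag_map ?h (U x)) = x"
        by (simp add: U(2) XG.hcomp_homogeneous[OF that(2)])
    qed
    also have "\<dots> = hcomp (dga_grade D) k (?\<psi> i (U x))"
    proof (rule frag_eval_frag_map[OF U(1)])
      fix d :: 'd and y assume "(d, y) \<in> UNIV \<times> grade X 0"
      then have "\<psi> i y \<in> dga_grade D 0" using \<psi>D that(1) by simp
      have "hcomp (dga_grade D) k (d * \<psi> i y) = hcomp (dga_grade D) k d * \<psi> i y"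
        using UNIV_I[of d]
      proof (induction d rule: D.graded.graded_induct)
        case (homogeneous j b)
        then show ?case
          using D.grade_mult[of b j "\<psi> i y" 0] \<open>\<psi> i y \<in> dga_grade D 0\<close>
          by (simp add: D.graded.hcomp_homogeneous[of _ j])
      qed (simp add: distrib_right D.graded.hcomp_add)
      then show "fst (?h (d, y)) * \<psi> i (snd (?h (d, y))) = hcomp (dga_grade D) k (d * \<psi> i y)"
        by simp
    qed (rule hdiff)
    finally show ?thesis
      using D.graded.hcomp_props(2)[OF UNIV_I] by simp
  qed
  have "(\<Sum>i<n. lact X (\<phi> i x) (g i)) = x" for x
  proof -
    have "(\<Sum>i<n. lact X (?\<psi> i u) (g i)) = ?e u" if "?K u" for u
      using that
    proof (induction u rule: frag_induction)
      case zero
      show ?case by (simp add: left_module_zero_act[OF D_module])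
    next
      case (one p)
      obtain d y where p: "p = (d, y)" "y \<in> grade X 0" using one by auto
      have "(\<Sum>i<n. lact X (d * \<psi> i y) (g i)) = lact X d (\<Sum>i<n. lact X (\<psi> i y) (g i))"
        by (simp add: left_module_act_sum[OF D_module] lact_lact)
      then show ?case
        by (simp add: p sum)
    next
      case (diff v w)
      have "lact X (c - d) z = lact X c z - lact X d z" for c d z
        using lact_add_left[of "c - d" d z] by (simp add: algebra_simps)
      with diff show ?case
        by (simp add: frag_eval_diff sum_subtractf)
    qed
    from this[OF U(1)] show ?thesis
      by (simp add: \<phi>_def U(2))
  qed
  then have "graded_dual_basis n g \<phi>"
    using g \<phi>_add \<phi>_lin \<phi>_grade
    by (auto simp: graded_dual_basis_def dual_basis_def left_module_hom_def)
  then show ?thesis by (intro exI[of _ \<phi>])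
qed

lemma degree_zero_iff_graded_dual_basis:
  "degree_zero X \<in> lproj A (degree_zero_alg D) (degree_zero_alg E) \<and> mult_map_iso D E X \<longleftrightarrow>
    (\<exists>n g \<phi>. graded_dual_basis n g \<phi>)"
  unfolding mult_map_iso_iff_bij degree_zero_lproj_iff
  using graded_dual_basis_imp_mult_map_bij graded_dual_basis_imp_degree_zero
    mult_map_bij_imp_graded_dual_basis by blast

end

section \<open>Graded direct summands of free modules\<close>

lemma sum_fun_apply: "(\<Sum>k\<in>S. b k) i = (\<Sum>k\<in>S. (b k :: 'i \<Rightarrow> 'v::ab_group_add) i)"
  by (induction S rule: infinite_finite_induct) auto

lemma free_power_submoduleI:
  fixes P :: "(nat \<Rightarrow> 'd::{ring,monoid_mult}) set"
  assumes "0 \<in> P" "\<And>b c. b \<in> P \<Longrightarrow> c \<in> P \<Longrightarrow> b - c \<in> P"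
    "\<And>a c. c \<in> P \<Longrightarrow> free_power_lact a c \<in> P"
  shows "left_module UNIV P free_power_lact"
  using assms by unfold_locales (auto simp: free_power_lact_def fun_eq_iff algebra_simps)

text \<open>Scalars act through the unit: \<open>z *\<^sub>C c\<close> is the action of the ring element \<open>z *\<^sub>C 1\<close>.\<close>

lemma free_power_submodule_subspace:
  fixes P :: "(nat \<Rightarrow> 'd::complex_algebra) set"
  assumes "left_module UNIV P free_power_lact"
  shows "csubspace P"
proof -
  interpret left_module UNIV P free_power_lact by fact
  have "z *\<^sub>C c \<in> P" if "c \<in> P" for z c
  proof -
    have "z *\<^sub>C c = free_power_lact (z *\<^sub>C 1) c"
      by (simp add: scaleC_fun_def free_power_lact_def scaleC_mult_left)
    then show ?thesis
      using act_mem[OF UNIV_I that] by simp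
  qed
  then show ?thesis
    using zero_mem left_module_add_mem[OF assms]
    by (simp add: complex_vector.subspace_def)
qed

context comodule_dg_algebra
begin

definition vcomp :: "int \<Rightarrow> (nat \<Rightarrow> 'd) \<Rightarrow> nat \<Rightarrow> 'd"
  where "vcomp k c = (\<lambda>i. hcomp (dga_grade D) k (c i))"

lemma vcomp_mem: "c \<in> free_power m \<Longrightarrow> vcomp k c \<in> free_power_grade D m k"
  by (simp add: vcomp_def free_power_grade_def free_power_def graded.hcomp_0
      graded.hcomp_props(2))

lemma vcomp_decomposition:
  assumes "c \<in> free_power m"
  shows "finite {k. vcomp k c \<noteq> 0}" "c = (\<Sum>k | vcomp k c \<noteq> 0. vcomp k c)"
proof -
  have "{k. vcomp k c \<noteq> 0} \<subseteq> (\<Union>i<m. {k. hcomp (dga_grade D) k (c i) \<noteq> 0})"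
  proof
    fix k assume "k \<in> {k. vcomp k c \<noteq> 0}"
    then obtain i where i: "hcomp (dga_grade D) k (c i) \<noteq> 0"
      by (auto simp: vcomp_def fun_eq_iff)
    then have "i < m"
      using assms by (auto simp: free_power_def graded.hcomp_0 not_le[symmetric])
    with i show "k \<in> (\<Union>i<m. {k. hcomp (dga_grade D) k (c i) \<noteq> 0})" by blast
  qed
  then show fin: "finite {k. vcomp k c \<noteq> 0}"
    by (rule finite_subset) (simp add: graded.hcomp_props(1))
  show "c = (\<Sum>k | vcomp k c \<noteq> 0. vcomp k c)"
  proof
    fix i
    have "{k. hcomp (dga_grade D) k (c i) \<noteq> 0} \<subseteq> {k. vcomp k c \<noteq> 0}"
      by (auto simp: vcomp_def fun_eq_iff)
    from graded.hcomp_sum_superset[OF UNIV_I fin this]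
    show "c i = (\<Sum>k | vcomp k c \<noteq> 0. vcomp k c) i"
      by (simp add: sum_fun_apply vcomp_def)
  qed
qed

lemma vcomp_unique:
  assumes "finite {k. b k \<noteq> 0}" "\<And>k. b k \<in> free_power_grade D m k" "c = (\<Sum>k | b k \<noteq> 0. b k)"
  shows "b k = vcomp k c"
proof
  fix i
  have "hcomp (dga_grade D) k (c i) = b k i"
    by (rule graded.hcomp_unique[OF UNIV_I assms(1)])
      (use assms in \<open>auto simp: free_power_grade_def sum_fun_apply\<close>)
  then show "b k i = vcomp k c i"
    by (simp add: vcomp_def)
qed

lemma free_power_grade_subspace: "csubspace (free_power_grade D m k)"
  using complex_vector.subspace_0[OF graded.grade_sub[of k]]
    complex_vector.subspace_add[OF graded.grade_sub[of k]]
    complex_vector.subspace_scale[OF graded.grade_sub[of k]]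
  by (auto simp: complex_vector.subspace_def free_power_grade_def free_power_def scaleC_fun_def)

text \<open>As in any graded module, a submodule is graded exactly when it contains the homogeneous
  components of its elements.\<close>

lemma graded_submodule_free_power_iff:
  "graded_submodule_free_power D m P \<longleftrightarrow>
    P \<subseteq> free_power m \<and> left_module UNIV P free_power_lact \<and> (\<forall>c\<in>P. \<forall>k. vcomp k c \<in> P)"
proof (cases "P \<subseteq> free_power m \<and> left_module UNIV P free_power_lact")
  case True
  then have P: "P \<subseteq> free_power m" and sub: "csubspace P"
    using free_power_submodule_subspace by auto
  let ?Q = "\<lambda>c b. finite {k. b k \<noteq> 0} \<and> (\<forall>k. b k \<in> P \<inter> free_power_grade D m k) \<and>
    c = (\<Sum>k | b k \<noteq> 0. b k)"
  have Q: "b = (\<lambda>k. vcomp k c)" if "?Q c b" for b c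
  proof
    show "b k = vcomp k c" for k
      by (rule vcomp_unique[of b m c]) (use that in blast)+
  qed
  have "graded_by P (\<lambda>k. P \<inter> free_power_grade D m k) \<longleftrightarrow> (\<forall>c\<in>P. \<exists>!b. ?Q c b)"
    using sub complex_vector.subspace_inter[OF sub free_power_grade_subspace]
    by (simp add: graded_by_def)
  also have "\<dots> \<longleftrightarrow> (\<forall>c\<in>P. \<forall>k. vcomp k c \<in> P)"
  proof (intro ball_cong refl iffI)
    fix c assume "c \<in> P" "\<exists>!b. ?Q c b"
    then obtain b where "?Q c b" by blast
    with Q[OF this] show "\<forall>k. vcomp k c \<in> P"
      by blast
  next
    fix c assume c: "c \<in> P" "\<forall>k. vcomp k c \<in> P"
    then have free: "c \<in> free_power m"
      using P by blast
    show "\<exists>!b. ?Q c b"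
    proof (rule ex1I[of "?Q c" "\<lambda>k. vcomp k c"])
      show "?Q c (\<lambda>k. vcomp k c)"
        using vcomp_decomposition[OF free] vcomp_mem[OF free] c(2) by simp
    qed (rule Q)
  qed
  finally show ?thesis
    using True by (simp add: graded_submodule_free_power_def)
qed (auto simp: graded_submodule_free_power_def)

end

context comodule_dg_bimodule
begin

text \<open>The functionals of a graded dual basis embed the module into \<open>D\<^sup>n\<close>; a complement is the
  kernel of the surjection \<open>D\<^sup>n \<rightarrow> \<XX>\<close> given by the generators.\<close>

lemma graded_dual_basis_imp_summand:
  assumes gdb: "graded_dual_basis n g \<phi>"
  shows "graded_summand_of_free_power D X n"
proof -
  have g: "\<And>i. i < n \<Longrightarrow> g i \<in> grade X 0"
    and \<phi>D: "\<And>i k x. i < n \<Longrightarrow> x \<in> grade X k \<Longrightarrow> \<phi> i x \<in> dga_grade D k"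
    and add: "\<And>i x y. i < n \<Longrightarrow> \<phi> i (x + y) = \<phi> i x + \<phi> i y"
    and lin: "\<And>i a x. i < n \<Longrightarrow> \<phi> i (lact X a x) = a * \<phi> i x"
    and expand: "\<And>x. (\<Sum>i<n. lact X (\<phi> i x) (g i)) = x"
    using gdb
    by (auto simp: graded_dual_basis_def dual_basis_def left_module_hom_def image_subset_iff)
  define s where "s = (\<lambda>x i. if i < n then \<phi> i x else 0)"
  define \<pi> where "\<pi> = (\<lambda>c. \<Sum>i<n. lact X (c i) (g i))"
  define Q where "Q = {c \<in> free_power n. \<pi> c = 0}"
  have \<pi>s: "\<pi> (s x) = x" for x
    using expand[of x] by (simp add: \<pi>_def s_def)
  have s_free: "s x \<in> free_power n" for x
    by (simp add: s_def free_power_def)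
  have s_add: "s (x + y) = s x + s y" for x y
    by (auto simp: s_def add fun_eq_iff)
  have s_diff: "s (x - y) = s x - s y" for x y
    using s_add[of "x - y" y] by (simp add: algebra_simps)
  have s_lact: "s (lact X a x) = free_power_lact a (s x)" for a x
    by (auto simp: s_def lin fun_eq_iff free_power_lact_def)
  have \<pi>_add: "\<pi> (b + c) = \<pi> b + \<pi> c" for b c
    by (simp add: \<pi>_def lact_add_left sum.distrib)
  have \<pi>_diff: "\<pi> (b - c) = \<pi> b - \<pi> c" for b c
    using \<pi>_add[of "b - c" c] by (simp add: algebra_simps)
  have \<pi>_lact: "\<pi> (free_power_lact a c) = lact X a (\<pi> c)" for a c
    by (simp add: \<pi>_def free_power_lact_def left_module_act_sum[OF D_module] lact_lact)
  have \<pi>_vcomp: "\<pi> (D.vcomp k c) = hcomp (grade X) k (\<pi> c)" for k c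
    unfolding \<pi>_def hcomp_X_sum[OF finite_lessThan]
    by (rule sum.cong) (auto simp: D.vcomp_def hcomp_lact_right g)
  have s_grade: "s x \<in> free_power_grade D n k" if "x \<in> grade X k" for x k
    using that s_free by (auto simp: free_power_grade_def s_def \<phi>D D.graded.grade_zero)
  have s_vcomp: "D.vcomp k (s x) = s (hcomp (grade X) k x)" for k x
    using UNIV_I[of x]
  proof (induction x rule: XG.graded_induct)
    case (homogeneous j x)
    have "D.vcomp k (s x) i = s (hcomp (grade X) k x) i" for i
    proof -
      have "\<phi> i 0 = 0" if "i < n" using add[OF that, of 0 0] by simp
      then show ?thesis
        using \<phi>D[OF _ homogeneous] XG.hcomp_homogeneous[OF homogeneous, of k]
        by (auto simp: D.vcomp_def s_def D.graded.hcomp_0 D.graded.hcomp_homogeneous[of _ j])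
    qed
    then show ?case by blast
  next
    case (add x y)
    have "D.vcomp k (s (x + y)) = D.vcomp k (s x) + D.vcomp k (s y)"
      by (auto simp: s_add D.vcomp_def D.graded.hcomp_add)
    also have "\<dots> = s (hcomp (grade X) k (x + y))"
      by (simp only: add.IH XG.hcomp_add[OF UNIV_I UNIV_I] s_add)
    finally show ?case .
  qed
  have vcomp_free: "D.vcomp k c \<in> free_power n" if "c \<in> free_power n" for k c
    using D.vcomp_mem[OF that] by (simp add: free_power_grade_def)
  have P: "graded_submodule_free_power D n (range s)"
    unfolding D.graded_submodule_free_power_iff
  proof (intro conjI)
    have "s 0 = 0" using s_add[of 0 0] by simp
    then have "0 \<in> range s" by (metis rangeI)
    then show "left_module UNIV (range s) free_power_lact"
      by (rule free_power_submoduleI) (auto simp: s_diff[symmetric] s_lact[symmetric])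
  qed (auto simp: s_free s_vcomp)
  have Q: "graded_submodule_free_power D n Q"
    unfolding D.graded_submodule_free_power_iff
  proof (intro conjI)
    have "\<pi> 0 = 0" using \<pi>_add[of 0 0] by simp
    moreover have "free_power_lact a c \<in> free_power n" if "c \<in> free_power n"
      for a and c :: "nat \<Rightarrow> 'd"
      using that by (simp add: free_power_def free_power_lact_def)
    moreover have "b - c \<in> free_power n" if "b \<in> free_power n" "c \<in> free_power n"
      for b c :: "nat \<Rightarrow> 'd"
      using that by (simp add: free_power_def)
    moreover have "(0 :: nat \<Rightarrow> 'd) \<in> free_power n"
      by (simp add: free_power_def)
    ultimately show "left_module UNIV Q free_power_lact"
      by (intro free_power_submoduleI)
        (auto simp: Q_def \<pi>_diff \<pi>_lact left_module_act_zero[OF D_module UNIV_I])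
  qed (auto simp: Q_def \<pi>_vcomp vcomp_free XG.hcomp_0)
  have inter: "range s \<inter> Q = {0}"
  proof -
    have "s 0 = 0" "\<pi> 0 = 0" using s_add[of 0 0] \<pi>_add[of 0 0] by simp_all
    then show ?thesis
      using \<pi>s s_free by (auto simp: Q_def) (metis rangeI)+
  qed
  have decomp: "{p + q | p q. p \<in> range s \<and> q \<in> Q} = free_power n"
  proof (intro subset_antisym subsetI)
    fix c assume "c \<in> {p + q | p q. p \<in> range s \<and> q \<in> Q}"
    then show "c \<in> free_power n"
      using s_free by (auto simp: Q_def free_power_def)
  next
    fix c :: "nat \<Rightarrow> 'd" assume c: "c \<in> free_power n"
    have "c - s (\<pi> c) \<in> Q"
      using c s_free[of "\<pi> c"] by (auto simp: Q_def \<pi>_diff \<pi>s free_power_def)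
    moreover have "c = s (\<pi> c) + (c - s (\<pi> c))" by simp
    ultimately show "c \<in> {p + q | p q. p \<in> range s \<and> q \<in> Q}" by blast
  qed
  have "bij_betw s UNIV (range s)"
    using \<pi>s by (intro inj_on_imp_bij_betw inj_on_inverseI[of _ \<pi>])
  moreover have "left_module_hom UNIV UNIV (lact X) (range s) free_power_lact s"
    by (auto simp: left_module_hom_def s_add s_lact)
  moreover have "s ` grade X k = range s \<inter> free_power_grade D n k" for k
  proof -
    have "x \<in> grade X k" if "s x \<in> free_power_grade D n k" for x
    proof -
      have "D.vcomp k (s x) = s x"
        using that by (auto simp: free_power_grade_def D.vcomp_def
            D.graded.hcomp_homogeneous[where j = k])
      then have "hcomp (grade X) k x = x"
        using s_vcomp[of k x] \<pi>s by metis
      then show ?thesis by (rule XG.homogeneousI[OF UNIV_I])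
    qed
    then show ?thesis using s_grade by blast
  qed
  ultimately show ?thesis
    unfolding graded_summand_of_free_power_def using P Q inter decomp by blast
qed

text \<open>The functionals are the coordinates of the embedding \<open>f\<close>.  The generators correspond to the
  projections to \<open>P\<close> of the standard basis vectors, which may be taken in degree zero because the
  standard basis lies in degree zero and both summands are graded.\<close>

lemma summand_imp_graded_dual_basis:
  assumes "graded_summand_of_free_power D X m"
  shows "\<exists>g \<phi>. graded_dual_basis m g \<phi>"
proof -
  obtain P Q f where P: "graded_submodule_free_power D m P"
    and Q: "graded_submodule_free_power D m Q"
    and inter: "P \<inter> Q = {0}" and decomp: "{p + q | p q. p \<in> P \<and> q \<in> Q} = free_power m"
    and f: "left_module_hom UNIV UNIV (lact X) P free_power_lact f" and bij: "bij_betw f UNIV P"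
    and f_grade: "\<And>k. f ` grade X k = P \<inter> free_power_grade D m k"
    using assms unfolding graded_summand_of_free_power_def by blast
  have Pm: "left_module UNIV P free_power_lact" and Qm: "left_module UNIV Q free_power_lact"
    and free: "P \<subseteq> free_power m"
    and Pc: "\<And>c k. c \<in> P \<Longrightarrow> D.vcomp k c \<in> P" and Qc: "\<And>c k. c \<in> Q \<Longrightarrow> D.vcomp k c \<in> Q"
    using P Q by (auto simp: D.graded_submodule_free_power_iff)
  have fP: "f x \<in> P" and f_add: "f (x + y) = f x + f y"
    and f_lact: "f (lact X a x) = free_power_lact a (f x)" for x y a
    using f by (auto simp: left_module_hom_def)
  define e :: "nat \<Rightarrow> nat \<Rightarrow> 'd" where "e = (\<lambda>i j. if j = i then 1 else 0)"
  have e_comp: "D.vcomp 0 (e i) = e i" for i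
    using D.graded.hcomp_homogeneous[OF D.grade_one, of 0]
    by (auto simp: D.vcomp_def e_def D.graded.hcomp_0)
  have "\<exists>p q. p \<in> P \<and> q \<in> Q \<and> p + q = e i" if "i < m" for i
  proof -
    have "e i \<in> free_power m" using that by (simp add: e_def free_power_def)
    then show ?thesis unfolding decomp[symmetric] by auto
  qed
  then obtain p q where pq: "\<And>i. i < m \<Longrightarrow> p i \<in> P" "\<And>i. i < m \<Longrightarrow> q i \<in> Q"
    "\<And>i. i < m \<Longrightarrow> p i + q i = e i"
    by metis
  define p0 where "p0 = (\<lambda>i. D.vcomp 0 (p i))"
  define q0 where "q0 = (\<lambda>i. D.vcomp 0 (q i))"
  have p0: "p0 i \<in> P \<inter> free_power_grade D m 0" if "i < m" for i
    using Pc D.vcomp_mem pq(1)[OF that] free by (auto simp: p0_def)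
  have q0: "q0 i \<in> Q" if "i < m" for i
    using Qc pq(2)[OF that] by (simp add: q0_def)
  have pq0: "p0 i + q0 i = e i" if "i < m" for i
  proof -
    have "D.vcomp 0 (p i + q i) = p0 i + q0 i"
      by (auto simp: p0_def q0_def D.vcomp_def D.graded.hcomp_add)
    then show ?thesis by (simp add: pq(3)[OF that] e_comp)
  qed
  have "\<exists>x\<in>grade X 0. f x = p0 i" if "i < m" for i
    using p0[OF that] f_grade[of 0] by (metis imageE)
  then obtain g where g: "\<And>i. i < m \<Longrightarrow> g i \<in> grade X 0" "\<And>i. i < m \<Longrightarrow> f (g i) = p0 i"
    by metis
  have "(\<Sum>i<m. lact X (f x i) (g i)) = x" for x
  proof -
    \<comment> \<open>\<open>?p + ?q\<close> is the standard expansion of \<open>f x\<close>; its part \<open>?q\<close> lies in both summands, so it is zero.\<close>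
    let ?p = "\<Sum>i<m. free_power_lact (f x i) (p0 i)"
    let ?q = "\<Sum>i<m. free_power_lact (f x i) (q0 i)"
    have "f (\<Sum>i<m. lact X (f x i) (g i)) = (\<Sum>i<m. f (lact X (f x i) (g i)))"
      by (rule left_module_hom_sum[OF D_module Pm f]) auto
    also have "\<dots> = ?p"
      by (rule sum.cong) (auto simp: f_lact g(2))
    finally have fp: "f (\<Sum>i<m. lact X (f x i) (g i)) = ?p" .
    have "?p + ?q = (\<Sum>i<m. free_power_lact (f x i) (e i))"
      unfolding sum.distrib[symmetric]
      by (rule sum.cong)
        (simp_all add: pq0[symmetric] free_power_lact_def fun_eq_iff distrib_left)
    also have "\<dots> = f x"
    proof
      fix j
      have "(\<Sum>i<m. free_power_lact (f x i) (e i)) j = (\<Sum>i<m. if i = j then f x i else 0)"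
        unfolding sum_fun_apply by (rule sum.cong) (auto simp: free_power_lact_def e_def)
      also have "\<dots> = f x j"
        using fP[of x] free by (auto simp: free_power_def)
      finally show "(\<Sum>i<m. free_power_lact (f x i) (e i)) j = f x j" .
    qed
    finally have sum: "?p + ?q = f x" .
    have pP: "?p \<in> P"
      by (rule left_module_sum_mem[OF Pm]) (use p0 in \<open>auto intro: left_module.act_mem[OF Pm]\<close>)
    have "?q \<in> Q"
      by (rule left_module_sum_mem[OF Qm]) (use q0 in \<open>auto intro: left_module.act_mem[OF Qm]\<close>)
    moreover have "?q = f x - ?p"
      using sum by (simp add: algebra_simps)
    then have "?q \<in> P"
      using left_module.diff_mem[OF Pm fP pP] by simp
    ultimately have "?q = 0"
      using inter by blast
    with sum fp have "f (\<Sum>i<m. lact X (f x i) (g i)) = f x"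
      by simp
    then show ?thesis
      using bij by (simp add: bij_betw_def inj_eq)
  qed
  moreover have "left_module_hom UNIV UNIV (lact X) UNIV (*) (\<lambda>x. f x i)" for i
    by (simp add: left_module_hom_def f_add f_lact free_power_lact_def)
  moreover have "f x i \<in> dga_grade D k" if "x \<in> grade X k" for x i k
    using f_grade[of k] that by (auto simp: free_power_grade_def)
  ultimately have "graded_dual_basis m g (\<lambda>i x. f x i)"
    using g(1) by (auto simp: graded_dual_basis_def dual_basis_def)
  then show ?thesis by blast
qed

end

theorem proposition3p2:
  fixes A :: "'a::complex_algebra hopf"
    and D :: "('a, 'd::complex_algebra) dg_alg"
    and E :: "('a, 'e::complex_algebra) dg_alg"
    and X :: "('a, 'd, 'e, 'x::complex_vector) dg_bimod"
  assumes "hopf_star_algebra A"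
    and "comodule_dg_algebra A D"
    and "comodule_dg_algebra A E"
    and "X \<in> dg_Mod A D E"
  shows "(X \<in> dg0_lproj A D E \<longleftrightarrow>
      degree_zero X \<in> lproj A (degree_zero_alg D) (degree_zero_alg E) \<and> mult_map_iso D E X)
    \<and> (degree_zero X \<in> lproj A (degree_zero_alg D) (degree_zero_alg E) \<and> mult_map_iso D E X \<longleftrightarrow>
      (\<exists>m. graded_summand_of_free_power D X m))"
proof -
  interpret comodule_dg_bimodule A D E X
    using assms(4) by (simp add: dg_Mod_def)
  have "(\<exists>m. graded_summand_of_free_power D X m) \<longleftrightarrow> (\<exists>n g \<phi>. graded_dual_basis n g \<phi>)"
    using graded_dual_basis_imp_summand summand_imp_graded_dual_basis by blast
  then show ?thesis
    using dg0_lproj_iff_graded_dual_basis degree_zero_iff_graded_dual_basis by blast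
qed

end
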